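(* Let $L$ be an integer $d\times d$ expansion matrix and let $F_{1}\subset \mathbb{Z}^{d}$ be a (finite) fundamental domain of $L(\mathbb{Z}^{d})$ in $\mathbb{Z}^{d}$ containing $0$. Set $\bar{r} = \|L^{-1}(F_1)\|/(1-\|L^{-1}\|)$, and let $(F_n)_{n\ge1}$ be defined by $F_{n+1}=L(F_n)+F_1$ for $n\geq 1$. Then the sequence $(F_{n})_{n}$ is Følner if and only if there exists $n \leq \frac{(6\bar{r})^{3d}-(6\bar{r})^d}{6}$ such that $F_n$ contains a translate of $C_{L,F_1}+(B(0,\bar{r})\cap \mathbb{Z}^{d})$. In particular, it is decidable (given $L$ and $F_1$) whether $(F_{n})_{n}$ is a Følner sequence.
   Context: $\|\cdot\|$ is the Euclidean norm on $\mathbb{R}^d$ and the induced operator norm on matrices; for a finite set $A$, $\|A\|=\max_{a\in A}\|a\|$; $B(0,r)$ is the Euclidean ball. $L$ is an expansion matrix if there is $\lambda>1$ with $\|Lx\|>\lambda\|x\|$ for all $x\in\mathbb{R}^d\setminus\{0\}$. A fundamental domain of $L(\mathbb{Z}^d)$ in $\mathbb{Z}^d$ is a set with exactly one representative of each class of $\mathbb{Z}^d/L(\mathbb{Z}^d)$. The sequence $(F_n)$ is Følner if $\lim_{n\to\infty}|F_n\Delta(m+F_n)|/|F_n|=0$ for every $m\in\mathbb{Z}^d$. The finite set $C_{L,F_1}\subset\mathbb{Z}^d$ is defined as follows: $C_0=\{0\}$, $C_{n+1}=L^{-1}(C_n+F_1+F_1-F_1)\cap\mathbb{Z}^d$ for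 $n\ge0$ (where sums and differences of sets are Minkowski sums and differences). This sequence is nondecreasing and eventually constant, and $C_{L,F_1}$ is its eventual value. It contains $0$. *)

theory Defs
  imports
    Complex_Main
    "HOL-Analysis.L2_Norm"
    "HOL-Library.Nat_Bijection"
    "HOL-Library.Set_Algebras"
    "Jordan_Normal_Form.Gauss_Jordan_Elimination"
begin

text \<open>
  The dimension \<open>d\<close> is an ordinary natural number, because the algorithm in the decidability
  statement receives it as part of its input. Hence vectors and matrices are those of
  \<open>Jordan_Normal_Form\<close>, and the lattice of integer points is \<open>carrier_vec d :: int vec set\<close>.
  Minkowski sums are the sums of \<open>HOL-Library.Set_Algebras\<close>. The operator \<open>-\<close> on sets is set
  difference, so the Minkowski difference is written \<open>A + uminus ` B\<close>.
\<close>

section \<open>Norms\<close>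

definition vnorm :: "real vec \<Rightarrow> real" where
  "vnorm v = L2_set (\<lambda>i. v $ i) {..<dim_vec v}"

definition opnorm :: "real mat \<Rightarrow> real" where
  "opnorm A = Sup {vnorm (A *\<^sub>v v) | v. v \<in> carrier_vec (dim_col A) \<and> vnorm v \<le> 1}"

definition set_norm :: "real vec set \<Rightarrow> real" where
  "set_norm A = Max (vnorm ` A)"

text \<open>
  The ball is closed. This matters: for the open ball the criterion fails already for \<open>d = 1\<close>,
  \<open>L = 3\<close>, \<open>F\<^sub>1 = {-2, 0, 2}\<close>, where the radius is \<open>1\<close> and \<open>C\<^bsub>L,F\<^sub>1\<^esub> = F\<^sub>1\<close>, while every
  \<open>F\<^sub>n\<close> consists of even numbers.
\<close>

definition lattice_ball :: "nat \<Rightarrow> real \<Rightarrow> int vec set" where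
  "lattice_ball d r = {z \<in> carrier_vec d. vnorm (map_vec real_of_int z) \<le> r}"

section \<open>Expansion matrices and fundamental domains\<close>

definition expansion_mat :: "nat \<Rightarrow> real mat \<Rightarrow> bool" where
  "expansion_mat d A \<longleftrightarrow> A \<in> carrier_mat d d \<and>
    (\<exists>c>1. \<forall>x\<in>carrier_vec d. x \<noteq> 0\<^sub>v d \<longrightarrow> vnorm (A *\<^sub>v x) > c * vnorm x)"

definition fundamental_domain :: "nat \<Rightarrow> int mat \<Rightarrow> int vec set \<Rightarrow> bool" where
  "fundamental_domain d L F \<longleftrightarrow> F \<subseteq> carrier_vec d \<and>
    (\<forall>z\<in>carrier_vec d. \<exists>!f. f \<in> F \<and> z - f \<in> (\<lambda>v. L *\<^sub>v v) ` carrier_vec d)"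

definition admissible :: "nat \<Rightarrow> int mat \<Rightarrow> int vec set \<Rightarrow> bool" where
  "admissible d L F1 \<longleftrightarrow> d \<ge> 1 \<and> L \<in> carrier_mat d d \<and>
    expansion_mat d (map_mat real_of_int L) \<and>
    finite F1 \<and> fundamental_domain d L F1 \<and> 0\<^sub>v d \<in> F1"

definition real_inverse :: "int mat \<Rightarrow> real mat" where
  "real_inverse L = the (mat_inverse (map_mat real_of_int L))"

definition rbar :: "int mat \<Rightarrow> int vec set \<Rightarrow> real" where
  "rbar L F1 = set_norm ((\<lambda>f. real_inverse L *\<^sub>v map_vec real_of_int f) ` F1)
     / (1 - opnorm (real_inverse L))"

section \<open>The sequence of sets, and its Foelner property\<close>

text \<open>The mathematical sequence starts with \<open>F_seq d L F1 1 = F1\<close>; the value \<open>{0}\<close> at index \<open>0\<close>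
  is an auxiliary one, compatible with the recursion.\<close>

primrec F_seq :: "nat \<Rightarrow> int mat \<Rightarrow> int vec set \<Rightarrow> nat \<Rightarrow> int vec set" where
  "F_seq d L F1 0 = {0\<^sub>v d}"
| "F_seq d L F1 (Suc n) = (\<lambda>v. L *\<^sub>v v) ` F_seq d L F1 n + F1"

definition folner :: "nat \<Rightarrow> (nat \<Rightarrow> int vec set) \<Rightarrow> bool" where
  "folner d F \<longleftrightarrow> (\<forall>m\<in>carrier_vec d.
     (\<lambda>n. real (card (sym_diff (F n) ({m} + F n))) / real (card (F n))) \<longlonglongrightarrow> 0)"

section \<open>The set \<open>C\<^bsub>L,F\<^sub>1\<^esub>\<close>\<close>

primrec C_seq :: "nat \<Rightarrow> int mat \<Rightarrow> int vec set \<Rightarrow> nat \<Rightarrow> int vec set" where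
  "C_seq d L F1 0 = {0\<^sub>v d}"
| "C_seq d L F1 (Suc n) =
     {z \<in> carrier_vec d. L *\<^sub>v z \<in> C_seq d L F1 n + F1 + F1 + uminus ` F1}"

definition C_set :: "nat \<Rightarrow> int mat \<Rightarrow> int vec set \<Rightarrow> int vec set" where
  "C_set d L F1 = (THE S. \<forall>\<^sub>F n in sequentially. C_seq d L F1 n = S)"

definition contains_translate :: "nat \<Rightarrow> int vec set \<Rightarrow> int vec set \<Rightarrow> bool" where
  "contains_translate d A B \<longleftrightarrow> (\<exists>t\<in>carrier_vec d. {t} + B \<subseteq> A)"

section \<open>Decidability\<close>

text \<open>
  \<open>recursive n f\<close>: the \<open>n\<close>-ary function \<open>f\<close> on natural numbers (the argument tuple being a list
  of length \<open>n\<close>) is total recursive, in Kleene's sense: minimization is only applied to regular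
  functions. Values of \<open>f\<close> on lists of other lengths are irrelevant.
\<close>

inductive recursive :: "nat \<Rightarrow> (nat list \<Rightarrow> nat) \<Rightarrow> bool" where
  zero: "recursive n (\<lambda>xs. 0)"
| succ: "recursive 1 (\<lambda>xs. Suc (xs ! 0))"
| proj: "i < n \<Longrightarrow> recursive n (\<lambda>xs. xs ! i)"
| comp: "recursive (length gs) f \<Longrightarrow> (\<forall>g\<in>set gs. recursive n g) \<Longrightarrow>
    recursive n (\<lambda>xs. f (map (\<lambda>g. g xs) gs))"
| prec: "recursive n f \<Longrightarrow> recursive (Suc (Suc n)) g \<Longrightarrow>
    recursive (Suc n) (\<lambda>xs. rec_nat (f (tl xs)) (\<lambda>k r. g (k # r # tl xs)) (hd xs))"
| mini: "recursive (Suc n) f \<Longrightarrow> (\<forall>xs. length xs = n \<longrightarrow> (\<exists>k. f (k # xs) = 0)) \<Longrightarrow>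
    recursive n (\<lambda>xs. LEAST k. f (k # xs) = 0)"

text \<open>\<open>decidable_on code D P\<close>: there is an algorithm that decides \<open>P x\<close>, given the code of any
  \<open>x \<in> D\<close>; its answer on other inputs is unspecified.\<close>

definition decidable_on :: "('a \<Rightarrow> nat) \<Rightarrow> 'a set \<Rightarrow> ('a \<Rightarrow> bool) \<Rightarrow> bool" where
  "decidable_on code D P \<longleftrightarrow>
     (\<exists>f. recursive 1 f \<and> (\<forall>x\<in>D. f [code x] = (if P x then 1 else 0)))"

text \<open>An input consists of the matrix and a list of the elements of the finite set \<open>F1\<close>, in any
  order and possibly with repetitions.\<close>

definition int_list_code :: "int list \<Rightarrow> nat" where
  "int_list_code xs = list_encode (map int_encode xs)"

definition input_code :: "int mat \<times> int vec list \<Rightarrow> nat" where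
  "input_code = (\<lambda>(L, fs).
     prod_encode (list_encode (map int_list_code (mat_to_list L)),
                  list_encode (map (\<lambda>f. int_list_code (list_of_vec f)) fs)))"

end

theory Submission
  imports Defs "Jordan_Normal_Form.Determinant"
begin

text \<open>
  Adding a fixed \<open>z\<close> to \<open>F\<^sub>n\<close> digit by digit, least significant digit first, is a run of the automaton
  whose states are the carries \<open>z \<in> \<int>\<^sup>d\<close> and which reads \<open>f \<in> F\<^sub>1\<close> by passing from \<open>z\<close> to the \<open>z'\<close> with
  \<open>z + f \<in> L z' + F\<^sub>1\<close>. The state \<open>0\<close> is absorbing, and \<open>z + x \<in> F\<^sub>n\<close> iff the digits of \<open>x \<in> F\<^sub>n\<close> lead
  from \<open>z\<close> to \<open>0\<close>. Hence the sequence is Foelner iff \<open>0\<close> is reachable from every state, and \<open>F\<^sub>n\<close> contains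
  a translate of a set \<open>S \<ni> 0\<close> iff a single word of length \<open>n\<close> sends all of \<open>S\<close> to \<open>0\<close>.

  All carries eventually lie in the ball of radius \<open>2r\<close>, and carries produced by reading only the
  digit \<open>0\<close> in the ball of radius \<open>r\<close>. As \<open>C + B(0, r) \<subseteq> B(0, 4r)\<close>, it suffices to wait until
  \<open>B(0, 4r)\<close> has been mapped into \<open>B(0, 2r)\<close>, which contains \<open>N \<le> (4r + 1)\<^sup>d\<close> lattice points, and then to
  read a greedy synchronizing word of length at most \<open>N(N - 1)/2\<close>. Covering \<open>\<real>\<^sup>d\<close> by translates of
  balls gives \<open>r \<ge> 1/2\<close>, so \<open>4r + 1 \<le> 6r\<close>, and the total length obeys the bound.

  For decidability, \<open>r\<close> is bounded by an explicit function of the input, and a failure of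
  reachability is witnessed by a set of nonzero carries in a box that the automaton does not leave.
\<close>

section \<open>Recursive functions\<close>

text \<open>The radii are fixed points. With \<open>q\<close> the norm of the inverse matrix, a
  digit contributes at most \<open>(1 - q) * r\<close> after division by \<open>L\<close>. A carry
  that takes up k digits per step thus obeys \<open>x' <= q * x + (1 - q) * k * r\<close> and drifts
  towards the ball of radius \<open>k * r\<close>: k = 1 if only zeros are read (the outgoing digit
  remains), k = 2 in general, and k = 3 for the set \<open>C\<close>, whose recursion involves three
  digits. Since \<open>C\<close> contains 0, a translate of \<open>C + B(0, r)\<close> covers one of
  \<open>B(0, r)\<close>, and zeros drive every carry into that ball.

  The decision procedure does not evaluate the criterion, in which a real number defined by a
  supremum occurs. Traps tolerate any overestimate of \<open>r\<close>, since a trap in a larger box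
  is still a trap. For such an overestimate the strict expansion has to become quantitative: the
  integer matrix \<open>L^T L - 1\<close> is positive definite, so its determinant has absolute
  value at least 1, and this bounds its smallest eigenvalue from below in terms of the size of the
  entries.\<close>

definition total_rec :: "nat \<Rightarrow> (nat list \<Rightarrow> nat) \<Rightarrow> bool" where
  "total_rec n f \<longleftrightarrow> (\<exists>g. recursive n g \<and> (\<forall>xs. length xs = n \<longrightarrow> g xs = f xs))"

text \<open>The rules of \<open>recursive\<close> yield particular functions on all lists, also on
  those of the wrong length. Ignoring the values there allows a function to be replaced by an
  equivalent formula.\<close>

lemma total_rec_cong:
  assumes "total_rec n f" "\<And>xs. length xs = n \<Longrightarrow> f xs = g xs"
  shows "total_rec n g"
  using assms unfolding total_rec_def by metis

lemma total_rec_proj: "i < n \<Longrightarrow> total_rec n (\<lambda>xs. xs ! i)"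
  unfolding total_rec_def using recursive.proj by blast

lemma total_rec_compose:
  assumes f: "total_rec (length gs) f" and gs: "\<And>g. g \<in> set gs \<Longrightarrow> total_rec n g"
  shows "total_rec n (\<lambda>xs. f (map (\<lambda>g. g xs) gs))"
proof -
  obtain f' where f': "recursive (length gs) f'" "\<And>ys. length ys = length gs \<Longrightarrow> f' ys = f ys"
    using f unfolding total_rec_def by blast
  have "\<forall>g\<in>set gs. \<exists>h. recursive n h \<and> (\<forall>xs. length xs = n \<longrightarrow> h xs = g xs)"
    using gs unfolding total_rec_def by blast
  then obtain h where h: "\<And>g. g \<in> set gs \<Longrightarrow> recursive n (h g)"
      "\<And>g xs. g \<in> set gs \<Longrightarrow> length xs = n \<Longrightarrow> h g xs = g xs"
    by metis
  have "recursive n (\<lambda>xs. f' (map (\<lambda>g. g xs) (map h gs)))"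
    using f'(1) h(1) by (intro recursive.comp) auto
  moreover have "f' (map (\<lambda>g. g xs) (map h gs)) = f (map (\<lambda>g. g xs) gs)" if "length xs = n" for xs
  proof -
    have "map (\<lambda>g. g xs) (map h gs) = map (\<lambda>g. g xs) gs"
      using h(2) that by simp
    then show ?thesis using f'(2) by (metis length_map)
  qed
  ultimately show ?thesis unfolding total_rec_def by blast
qed

lemma total_rec_compose1:
  assumes "total_rec 1 f" "total_rec n g"
  shows "total_rec n (\<lambda>xs. f [g xs])"
  using total_rec_compose[of "[g]" f n] assms by simp

text \<open>Composition takes a list of component functions, so dropping arguments means listing the
  projections that are kept.\<close>

lemma map_projections: "length xs = m + n \<Longrightarrow> map ((\<lambda>g. g xs) \<circ> (\<lambda>i xs. xs ! (m + i))) [0..<n] = drop m xs"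
  by (rule nth_equalityI) auto

lemma total_rec_drop:
  assumes "total_rec n f"
  shows "total_rec (m + n) (\<lambda>xs. f (drop m xs))"
proof -
  have "total_rec (m + n) (\<lambda>xs. f (map (\<lambda>g. g xs) (map (\<lambda>i xs. xs ! (m + i)) [0..<n])))"
    by (rule total_rec_compose) (use assms in \<open>auto intro: total_rec_proj\<close>)
  then show ?thesis
    by (rule total_rec_cong) (simp add: map_projections del: comp_apply)
qed

lemma total_rec_Suc:
  assumes "total_rec n f"
  shows "total_rec n (\<lambda>xs. Suc (f xs))"
proof -
  have "total_rec 1 (\<lambda>xs. Suc (xs ! 0))"
    unfolding total_rec_def using recursive.succ by blast
  from total_rec_compose1[OF this assms] show ?thesis by simp
qed

lemma total_rec_const: "total_rec n (\<lambda>xs. c)"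
proof (induction c)
  case 0
  show ?case unfolding total_rec_def using recursive.zero by blast
next
  case (Suc c)
  from total_rec_Suc[OF this] show ?case .
qed

text \<open>\<open>prec\<close> recurses on the first argument, with the others as parameters.
  Composing it with \<open>m\<close> and all projections lets the depth of the recursion depend on
  these parameters.\<close>

lemma total_rec_primrec:
  assumes b: "total_rec n b" and m: "total_rec n m"
    and h: "total_rec (2 + n) (\<lambda>ys. h (ys ! 0) (ys ! 1) (drop 2 ys))"
  shows "total_rec n (\<lambda>xs. rec_nat (b xs) (\<lambda>k r. h k r xs) (m xs))"
proof -
  obtain b' where b': "recursive n b'" "\<And>ys. length ys = n \<Longrightarrow> b' ys = b ys"
    using b unfolding total_rec_def by blast
  obtain h' where h': "recursive (Suc (Suc n)) h'"
    "\<And>ys. length ys = Suc (Suc n) \<Longrightarrow> h' ys = h (ys ! 0) (ys ! 1) (drop 2 ys)"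
    using h unfolding total_rec_def by (auto simp: numeral_2_eq_2)
  define R where "R = (\<lambda>xs. rec_nat (b' (tl xs)) (\<lambda>k r. h' (k # r # tl xs)) (hd xs))"
  have "recursive (Suc n) R"
    unfolding R_def by (rule recursive.prec[OF b'(1) h'(1)])
  then have R: "total_rec (Suc n) R" unfolding total_rec_def by blast
  define ps where "ps = map (\<lambda>i xs. (xs :: nat list) ! (0 + i)) [0..<n]"
  have "total_rec n (\<lambda>xs. R (map (\<lambda>g. g xs) (m # ps)))"
    by (rule total_rec_compose) (use R m in \<open>auto simp: ps_def intro: total_rec_proj\<close>)
  then show ?thesis
  proof (rule total_rec_cong)
    fix xs :: "nat list" assume len: "length xs = n"
    have ps: "map (\<lambda>g. g xs) ps = xs"
      unfolding ps_def map_map using map_projections[of xs 0 n] len by simp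
    have "rec_nat (b xs) (\<lambda>k r. h' (k # r # xs)) k = rec_nat (b xs) (\<lambda>k r. h k r xs) k" for k
      by (induction k) (simp_all add: h'(2) len)
    then show "R (map (\<lambda>g. g xs) (m # ps)) = rec_nat (b xs) (\<lambda>k r. h k r xs) (m xs)"
      unfolding R_def using ps len b'(2) by simp
  qed
qed

lemma total_rec_add:
  assumes "total_rec n f" "total_rec n g"
  shows "total_rec n (\<lambda>xs. f xs + g xs)"
proof -
  have "total_rec n (\<lambda>xs. rec_nat (f xs) (\<lambda>k r. Suc r) (g xs))"
    by (rule total_rec_primrec[OF assms]) (intro total_rec_Suc total_rec_proj, simp)
  moreover have "rec_nat a (\<lambda>k r. Suc r) c = a + c" for a c :: nat
    by (induction c) auto
  ultimately show ?thesis by simp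
qed

lemma total_rec_sum:
  assumes f: "total_rec (Suc n) (\<lambda>ys. f (ys ! 0) (drop 1 ys))" and m: "total_rec n m"
  shows "total_rec n (\<lambda>xs. \<Sum>k<m xs. f k xs)"
proof -
  \<comment> \<open>A recursion step receives counter, accumulator and parameters; the summand does
    not depend on the accumulator, so index 1 is skipped.\<close>
  define ps where "ps = (\<lambda>xs::nat list. xs ! 0) # map (\<lambda>i xs. xs ! (2 + i)) [0..<n]"
  have "total_rec (2 + n) (\<lambda>xs. (\<lambda>ys. f (ys ! 0) (drop 1 ys)) (map (\<lambda>g. g xs) ps))"
    by (rule total_rec_compose) (use f in \<open>auto simp: ps_def intro: total_rec_proj\<close>)
  then have f': "total_rec (2 + n) (\<lambda>xs. f (xs ! 0) (drop 2 xs))"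
    by (rule total_rec_cong)
       (simp add: ps_def map_projections[where m = 2, simplified] del: comp_apply)
  have "total_rec n (\<lambda>xs. rec_nat 0 (\<lambda>k r. r + f k xs) (m xs))"
    by (rule total_rec_primrec[OF total_rec_const m], rule total_rec_add[OF total_rec_proj f']) simp
  moreover have "rec_nat 0 (\<lambda>k r. r + f k xs) c = (\<Sum>k<c. f k xs)" for c xs
    by (induction c) auto
  ultimately show ?thesis by simp
qed

lemma total_rec_pred:
  assumes "total_rec n f"
  shows "total_rec n (\<lambda>xs. f xs - 1)"
proof -
  have "total_rec n (\<lambda>xs. rec_nat 0 (\<lambda>k r. k) (f xs))"
    by (rule total_rec_primrec[OF total_rec_const assms]) (intro total_rec_proj, simp)
  moreover have "rec_nat 0 (\<lambda>k r. k) c = c - 1" for c :: nat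
    by (cases c) auto
  ultimately show ?thesis by simp
qed

lemma total_rec_diff:
  assumes "total_rec n f" "total_rec n g"
  shows "total_rec n (\<lambda>xs. f xs - g xs)"
proof -
  have "total_rec n (\<lambda>xs. rec_nat (f xs) (\<lambda>k r. r - 1) (g xs))"
    by (rule total_rec_primrec[OF assms]) (intro total_rec_pred total_rec_proj, simp)
  moreover have "rec_nat a (\<lambda>k r. r - 1) c = a - c" for a c :: nat
    by (induction c) auto
  ultimately show ?thesis by simp
qed

text \<open>Truncated subtraction makes \<open>1 - (f - g)\<close> the truth value of the
  comparison.\<close>

lemma total_rec_le:
  assumes "total_rec n f" "total_rec n g"
  shows "total_rec n (\<lambda>xs. of_bool (f xs \<le> g xs))"
  by (rule total_rec_cong[OF total_rec_diff[OF total_rec_const[of n 1] total_rec_diff[OF assms]]])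
     auto

lemma total_rec_triangle:
  assumes "total_rec n f"
  shows "total_rec n (\<lambda>xs. triangle (f xs))"
proof -
  have "total_rec n (\<lambda>xs. \<Sum>k<f xs. Suc k)"
    by (rule total_rec_sum[OF _ assms]) (intro total_rec_Suc total_rec_proj, simp)
  moreover have "(\<Sum>k<c. Suc k) = triangle c" for c
    by (induction c) auto
  ultimately show ?thesis by simp
qed

section \<open>Inverting the Cantor pairing\<close>

definition pfst :: "nat \<Rightarrow> nat" where "pfst z = fst (prod_decode z)"
definition psnd :: "nat \<Rightarrow> nat" where "psnd z = snd (prod_decode z)"

lemma pfst_encode [simp]: "pfst (prod_encode (a, b)) = a"
  and psnd_encode [simp]: "psnd (prod_encode (a, b)) = b"
  by (simp_all add: pfst_def psnd_def)

text \<open>The antidiagonal \<open>a + b\<close> of the pair with code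
  \<open>z = triangle (a + b) + a\<close>, found by counting the positive triangular numbers up to
  \<open>z\<close>. A bounded sum avoids minimization.\<close>

definition pdiag :: "nat \<Rightarrow> nat" where
  "pdiag z = (\<Sum>t<z. of_bool (triangle (Suc t) \<le> z))"

lemma triangle_mono: "m \<le> n \<Longrightarrow> triangle m \<le> triangle n"
  by (induction rule: dec_induct) auto

lemma le_triangle: "n \<le> triangle n"
  by (induction n) auto

text \<open>As \<open>triangle (a + b) <= z < triangle (a + b + 1)\<close>, exactly the
  \<open>t\<close> below \<open>a + b\<close> are counted; the cut-off at \<open>z\<close> loses
  none of them, because \<open>a + b <= triangle (a + b) <= z\<close>.\<close>

lemma pdiag_eq: "pdiag z = pfst z + psnd z"
proof -
  obtain a b where z: "z = prod_encode (a, b)"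
    by (metis prod_decode_inverse surj_pair)
  have z': "z = triangle (a + b) + a" using z by (simp add: prod_encode_def)
  have iff: "triangle (Suc t) \<le> z \<longleftrightarrow> t < a + b" for t
  proof
    assume *: "triangle (Suc t) \<le> z"
    show "t < a + b"
    proof (rule ccontr)
      assume "\<not> t < a + b"
      then have "triangle (Suc (a + b)) \<le> triangle (Suc t)" by (intro triangle_mono) simp
      then show False using * z' by simp
    qed
  next
    assume "t < a + b"
    then have "triangle (Suc t) \<le> triangle (a + b)" by (intro triangle_mono) simp
    then show "triangle (Suc t) \<le> z" using z' by simp
  qed
  have "a + b \<le> z" using le_triangle[of "a + b"] z' by linarith
  then have "{t. t < z \<and> t < a + b} = {..<a + b}" by auto
  have "pdiag z = card {t \<in> {..<z}. triangle (Suc t) \<le> z}"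
    unfolding pdiag_def of_bool_def by (subst sum.inter_filter[symmetric]) simp_all
  also have "\<dots> = card {..<a + b}"
    using \<open>{t. t < z \<and> t < a + b} = {..<a + b}\<close> iff by simp
  finally show ?thesis by (simp add: z)
qed

lemma pfst_eq: "pfst z = z - triangle (pdiag z)"
proof -
  obtain a b where z: "z = prod_encode (a, b)"
    by (metis prod_decode_inverse surj_pair)
  then have "z = triangle (a + b) + a" by (simp add: prod_encode_def)
  moreover have "pfst z = a" "psnd z = b" using z by simp_all
  ultimately show ?thesis using z by (simp add: pdiag_eq)
qed

lemma psnd_eq: "psnd z = pdiag z - pfst z"
  by (simp add: pdiag_eq)

lemma total_rec_pdiag:
  assumes "total_rec n f"
  shows "total_rec n (\<lambda>xs. pdiag (f xs))"
  unfolding pdiag_def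
  by (rule total_rec_sum[OF _ assms])
     (intro total_rec_le total_rec_triangle total_rec_Suc total_rec_proj
        total_rec_drop[of n f 1, unfolded plus_1_eq_Suc] assms, simp)

lemma total_rec_pfst:
  assumes "total_rec n f"
  shows "total_rec n (\<lambda>xs. pfst (f xs))"
  unfolding pfst_eq by (intro total_rec_diff total_rec_triangle total_rec_pdiag assms)

lemma total_rec_psnd:
  assumes "total_rec n f"
  shows "total_rec n (\<lambda>xs. psnd (f xs))"
  unfolding psnd_eq by (intro total_rec_diff total_rec_pfst total_rec_pdiag assms)

lemma total_rec_pair:
  assumes "total_rec n f" "total_rec n g"
  shows "total_rec n (\<lambda>xs. prod_encode (f xs, g xs))"
  unfolding prod_encode_def by (simp, intro total_rec_add total_rec_triangle assms)

section \<open>Computable unary functions\<close>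

definition computable :: "(nat \<Rightarrow> nat) \<Rightarrow> bool" where
  "computable f \<longleftrightarrow> total_rec 1 (\<lambda>xs. f (xs ! 0))"

lemma total_rec_computable:
  assumes "computable f" "total_rec n g"
  shows "total_rec n (\<lambda>xs. f (g xs))"
  using total_rec_compose1[OF assms(1)[unfolded computable_def] assms(2)] by simp

lemma computable_id: "computable (\<lambda>x. x)"
  unfolding computable_def by (rule total_rec_proj) simp

lemma computable_const: "computable (\<lambda>x. c)"
  unfolding computable_def by (rule total_rec_const)

lemma computable_Suc: "computable f \<Longrightarrow> computable (\<lambda>x. Suc (f x))"
  unfolding computable_def by (rule total_rec_Suc)

lemma computable_add: "computable f \<Longrightarrow> computable g \<Longrightarrow> computable (\<lambda>x. f x + g x)"
  unfolding computable_def by (rule total_rec_add)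

lemma computable_diff: "computable f \<Longrightarrow> computable g \<Longrightarrow> computable (\<lambda>x. f x - g x)"
  unfolding computable_def by (rule total_rec_diff)

lemma computable_le: "computable f \<Longrightarrow> computable g \<Longrightarrow> computable (\<lambda>x. of_bool (f x \<le> g x))"
  unfolding computable_def by (rule total_rec_le)

lemma computable_pfst: "computable f \<Longrightarrow> computable (\<lambda>x. pfst (f x))"
  unfolding computable_def by (rule total_rec_pfst)

lemma computable_psnd: "computable f \<Longrightarrow> computable (\<lambda>x. psnd (f x))"
  unfolding computable_def by (rule total_rec_psnd)

lemma computable_pair: "computable f \<Longrightarrow> computable g \<Longrightarrow> computable (\<lambda>x. prod_encode (f x, g x))"
  unfolding computable_def by (rule total_rec_pair)

lemma computable_compose:
  assumes "computable f" "computable g"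
  shows "computable (\<lambda>x. f (g x))"
  using total_rec_computable[OF assms(1) assms(2)[unfolded computable_def]]
  unfolding computable_def .

text \<open>Pairing makes unary functions sufficient: a function of two variables is one of
  \<open>pfst p\<close> and \<open>psnd p\<close>. The rules for recursion, sums and bounded
  quantifiers treat their bound variables in this way.\<close>

lemma computable_compose2:
  assumes "computable (\<lambda>p. h (pfst p) (psnd p))" "computable f" "computable g"
  shows "computable (\<lambda>x. h (f x) (g x))"
  using computable_compose[OF assms(1) computable_pair[OF assms(2,3)]] by simp

lemma computable_rec:
  assumes b: "computable b" and m: "computable m"
    and h: "computable (\<lambda>p. h (pfst p) (pfst (psnd p)) (psnd (psnd p)))"
  shows "computable (\<lambda>x. rec_nat (b x) (\<lambda>k r. h x k r) (m x))"
proof -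
  have "total_rec (2 + 1) (\<lambda>ys. (\<lambda>p. h (pfst p) (pfst (psnd p)) (psnd (psnd p)))
          (prod_encode (ys ! 2, prod_encode (ys ! 0, ys ! 1))))"
    by (rule total_rec_computable[OF h]) (intro total_rec_pair total_rec_proj; simp)
  then have "total_rec (2 + 1) (\<lambda>ys. (\<lambda>k r xs. h (xs ! 0) k r) (ys ! 0) (ys ! 1) (drop 2 ys))"
    by (rule total_rec_cong) simp
  from total_rec_primrec[OF b[unfolded computable_def] m[unfolded computable_def] this]
  show ?thesis unfolding computable_def by simp
qed

lemma computable_mult:
  assumes "computable f" "computable g"
  shows "computable (\<lambda>x. f x * g x)"
proof -
  have "computable (\<lambda>x. rec_nat 0 (\<lambda>k r. r + f x) (g x))"
    by (rule computable_rec)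
       (intro computable_const assms computable_add computable_psnd computable_id
          computable_compose[OF assms(1)] computable_pfst)+
  moreover have "rec_nat 0 (\<lambda>k r. r + a) c = a * c" for a c :: nat
    by (induction c) auto
  ultimately show ?thesis by simp
qed

lemma computable_power:
  assumes "computable f" "computable g"
  shows "computable (\<lambda>x. f x ^ g x)"
proof -
  have "computable (\<lambda>x. rec_nat 1 (\<lambda>k r. r * f x) (g x))"
    by (rule computable_rec)
       (intro computable_const assms computable_mult computable_psnd computable_id
          computable_compose[OF assms(1)] computable_pfst)+
  moreover have "rec_nat 1 (\<lambda>k r. r * a) c = a ^ c" for a c :: nat
    by (induction c) auto
  ultimately show ?thesis by simp
qed

lemma computable_sum:
  assumes h: "computable (\<lambda>p. h (pfst p) (psnd p))" and m: "computable m"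
  shows "computable (\<lambda>x. \<Sum>k<m x. h x k)"
proof -
  have "computable (\<lambda>x. rec_nat 0 (\<lambda>k r. r + h x k) (m x))"
    by (rule computable_rec)
       (intro computable_const m computable_add computable_psnd computable_id
          computable_compose2[OF h] computable_pfst)+
  moreover have "rec_nat 0 (\<lambda>k r. r + h x k) c = (\<Sum>k<c. h x k)" for x c
    by (induction c) auto
  ultimately show ?thesis by simp
qed

section \<open>Decidable predicates and bounded search\<close>

definition decidable :: "(nat \<Rightarrow> bool) \<Rightarrow> bool" where
  "decidable P \<longleftrightarrow> computable (\<lambda>x. of_bool (P x))"

lemma decidable_le: "computable f \<Longrightarrow> computable g \<Longrightarrow> decidable (\<lambda>x. f x \<le> g x)"
  unfolding decidable_def by (rule computable_le)

lemma decidable_not: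
  assumes "decidable P"
  shows "decidable (\<lambda>x. \<not> P x)"
proof -
  have "computable (\<lambda>x. 1 - of_bool (P x))"
    using assms unfolding decidable_def by (intro computable_diff computable_const)
  moreover have "(1 - of_bool b :: nat) = of_bool (\<not> b)" for b by simp
  ultimately show ?thesis unfolding decidable_def by simp
qed

lemma decidable_conj:
  assumes "decidable P" "decidable Q"
  shows "decidable (\<lambda>x. P x \<and> Q x)"
  using computable_mult[OF assms[unfolded decidable_def]] unfolding decidable_def
  by (simp flip: of_bool_conj)

lemma decidable_imp: "decidable P \<Longrightarrow> decidable Q \<Longrightarrow> decidable (\<lambda>x. P x \<longrightarrow> Q x)"
  using decidable_not[OF decidable_conj[OF _ decidable_not], of P Q] by simp

lemma decidable_less: "computable f \<Longrightarrow> computable g \<Longrightarrow> decidable (\<lambda>x. f x < g x)"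
  using decidable_not[OF decidable_le, of g f] by (simp add: not_le)

lemma decidable_eq: "computable f \<Longrightarrow> computable g \<Longrightarrow> decidable (\<lambda>x. f x = g x)"
  using decidable_conj[OF decidable_le decidable_le, of f g g f] by (simp add: eq_iff)

lemma decidable_bex:
  assumes "decidable (\<lambda>p. P (pfst p) (psnd p))" "computable m"
  shows "decidable (\<lambda>x. \<exists>k<m x. P x k)"
proof -
  have "decidable (\<lambda>x. 0 < (\<Sum>k<m x. of_bool (P x k) :: nat))"
    by (intro decidable_less computable_const computable_sum assms(2) assms(1)[unfolded decidable_def])
  moreover have "0 < (\<Sum>k<m x. of_bool (P x k) :: nat) \<longleftrightarrow> (\<exists>k<m x. P x k)" for x
    by (auto simp: sum_nonneg_eq_0_iff[symmetric] neq0_conv[symmetric] simp del: neq0_conv)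
  ultimately show ?thesis by simp
qed

lemma decidable_ball:
  assumes "decidable (\<lambda>p. P (pfst p) (psnd p))" "computable m"
  shows "decidable (\<lambda>x. \<forall>k<m x. P x k)"
  using decidable_not[OF decidable_bex[OF decidable_not[OF assms(1)] assms(2)]] by simp

lemma computable_if:
  assumes "decidable P" "computable f" "computable g"
  shows "computable (\<lambda>x. if P x then f x else g x)"
proof -
  have "computable (\<lambda>x. of_bool (P x) * f x + of_bool (\<not> P x) * g x)"
    using assms decidable_not[OF assms(1)] unfolding decidable_def
    by (intro computable_add computable_mult)
  moreover have "(\<lambda>x. of_bool (P x) * f x + of_bool (\<not> P x) * g x) = (\<lambda>x. if P x then f x else g x)"
    by auto
  ultimately show ?thesis by simp
qed

text \<open>The quotient counts the positive multiples of \<open>b\<close> up to \<open>a\<close>;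
  there are at most \<open>a\<close> of them, which bounds the sum.\<close>

lemma div_eq_sum: "(a::nat) div b = (if b = 0 then 0 else \<Sum>k<a. of_bool (Suc k * b \<le> a))"
proof (cases "b = 0")
  case False
  have "Suc k * b \<le> a \<longleftrightarrow> k < a div b" for k
    using False by (simp add: less_eq_div_iff_mult_less_eq Suc_le_eq[symmetric])
  moreover have "a div b \<le> a" by simp
  then have "{k. k < a \<and> k < a div b} = {..<a div b}" using less_le_trans by blast
  moreover have "(\<Sum>k<a. of_bool (Suc k * b \<le> a)) = card {k \<in> {..<a}. Suc k * b \<le> a}"
    unfolding of_bool_def by (subst sum.inter_filter[symmetric]) simp_all
  ultimately show ?thesis using False by simp
qed simp

lemma computable_div:
  assumes "computable f" "computable g"
  shows "computable (\<lambda>x. f x div g x)"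
  unfolding div_eq_sum
  by (intro computable_if decidable_eq computable_const computable_sum computable_le computable_mult
      computable_Suc computable_psnd computable_pfst computable_id assms
      computable_compose[OF assms(1)] computable_compose[OF assms(2)])

lemma computable_mod:
  assumes "computable f" "computable g"
  shows "computable (\<lambda>x. f x mod g x)"
  using computable_diff[OF assms(1) computable_mult[OF computable_div[OF assms] assms(2)]]
  by (simp add: minus_div_mult_eq_mod)

text \<open>With integers written as differences of naturals, sums, products and equality need no
  case distinction on signs.\<close>

definition computable_int :: "(nat \<Rightarrow> int) \<Rightarrow> bool" where
  "computable_int f \<longleftrightarrow> (\<exists>a b. computable a \<and> computable b \<and> (\<forall>x. f x = int (a x) - int (b x)))"

lemma computable_int_of_nat: "computable f \<Longrightarrow> computable_int (\<lambda>x. int (f x))"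
  unfolding computable_int_def using computable_const[of 0]
  by (intro exI[of _ f] exI[of _ "\<lambda>x. 0"]) auto

lemma computable_int_diff:
  assumes "computable_int f" "computable_int g"
  shows "computable_int (\<lambda>x. f x - g x)"
proof -
  from assms obtain a b a' b' where "computable a" "computable b" "\<And>x. f x = int (a x) - int (b x)"
    "computable a'" "computable b'" "\<And>x. g x = int (a' x) - int (b' x)"
    unfolding computable_int_def by blast
  then show ?thesis unfolding computable_int_def
    by (intro exI[of _ "\<lambda>x. a x + b' x"] exI[of _ "\<lambda>x. b x + a' x"])
       (auto intro: computable_add)
qed

lemma computable_int_add:
  assumes "computable_int f" "computable_int g"
  shows "computable_int (\<lambda>x. f x + g x)"
  using computable_int_diff[OF assms(1)
      computable_int_diff[OF computable_int_of_nat[OF computable_const[of 0]] assms(2)]]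
  by simp

lemma computable_int_mult:
  assumes "computable_int f" "computable_int g"
  shows "computable_int (\<lambda>x. f x * g x)"
proof -
  from assms obtain a b a' b' where *: "computable a" "computable b" "\<And>x. f x = int (a x) - int (b x)"
    "computable a'" "computable b'" "\<And>x. g x = int (a' x) - int (b' x)"
    unfolding computable_int_def by blast
  have "computable (\<lambda>x. a x * a' x + b x * b' x)" "computable (\<lambda>x. a x * b' x + b x * a' x)"
    by (intro computable_add computable_mult *)+
  moreover have "f x * g x = int (a x * a' x + b x * b' x) - int (a x * b' x + b x * a' x)" for x
    unfolding *(3,6) by (simp add: algebra_simps)
  ultimately show ?thesis unfolding computable_int_def by blast
qed

lemma computable_int_sum:
  assumes "computable_int (\<lambda>p. f (pfst p) (psnd p))" "computable m"
  shows "computable_int (\<lambda>x. \<Sum>k<m x. f x k)"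
proof -
  from assms(1) obtain a b where ab: "computable a" "computable b"
    "\<And>p. f (pfst p) (psnd p) = int (a p) - int (b p)"
    unfolding computable_int_def by blast
  have "f x k = int (a (prod_encode (x, k))) - int (b (prod_encode (x, k)))" for x k
    using ab(3)[of "prod_encode (x, k)"] by simp
  then have "(\<Sum>k<m x. f x k) = int (\<Sum>k<m x. a (prod_encode (x, k))) - int (\<Sum>k<m x. b (prod_encode (x, k)))" for x
    by (simp add: sum_subtractf)
  then show ?thesis unfolding computable_int_def using ab(1,2)
    by (intro exI[of _ "\<lambda>x. \<Sum>k<m x. a (prod_encode (x, k))"] exI[of _ "\<lambda>x. \<Sum>k<m x. b (prod_encode (x, k))"])
       (auto intro!: computable_sum assms(2) simp: pfst_def psnd_def)
qed

lemma computable_int_decode: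
  assumes "computable f"
  shows "computable_int (\<lambda>x. int_decode (f x))"
proof -
  have eq: "int_decode n = int (if n mod 2 = 0 then n div 2 else 0) - int (if n mod 2 = 0 then 0 else Suc (n div 2))" for n
    by (auto simp: int_decode_def sum_decode_def even_iff_mod_2_eq_zero)
  show ?thesis unfolding eq
    by (intro computable_int_diff computable_int_of_nat computable_if decidable_eq computable_mod
        computable_div computable_const computable_Suc assms)
qed

lemma decidable_int_eq:
  assumes "computable_int f" "computable_int g"
  shows "decidable (\<lambda>x. f x = g x)"
proof -
  from assms obtain a b a' b' where *: "computable a" "computable b" "\<And>x. f x = int (a x) - int (b x)"
    "computable a'" "computable b'" "\<And>x. g x = int (a' x) - int (b' x)"
    unfolding computable_int_def by blast
  have "decidable (\<lambda>x. a x + b' x = a' x + b x)"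
    by (intro decidable_eq computable_add *)
  moreover have "(a x + b' x = a' x + b x) \<longleftrightarrow> f x = g x" for x
    unfolding * by linarith
  ultimately show ?thesis by simp
qed

section \<open>Codes of lists\<close>

definition list_code_nth :: "nat \<Rightarrow> nat \<Rightarrow> nat" where
  "list_code_nth c i = pfst (rec_nat c (\<lambda>k r. psnd (r - 1)) i - 1)"

definition list_code_length :: "nat \<Rightarrow> nat" where
  "list_code_length c = (\<Sum>i<c. of_bool (rec_nat c (\<lambda>k r. psnd (r - 1)) i \<noteq> 0))"

text \<open>A nonempty list has the code \<open>Suc (prod_encode (x, list_encode xs))\<close>, so
  \<open>psnd (r - 1)\<close> is the code of the tail; the code 0 of the empty list is mapped to
  itself.\<close>

lemma list_code_drop: "rec_nat (list_encode xs) (\<lambda>k r. psnd (r - 1)) i = list_encode (drop i xs)"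
proof (induction i)
  case (Suc i)
  show ?case
  proof (cases "drop i xs")
    case Nil
    then show ?thesis using Suc by (simp add: psnd_def prod_decode_def prod_decode_aux.simps)
  next
    case (Cons y ys)
    then have "drop (Suc i) xs = ys" by (metis drop_Suc list.sel(3) tl_drop)
    then show ?thesis using Suc Cons by simp
  qed
qed simp

lemma list_code_nth_encode: "i < length xs \<Longrightarrow> list_code_nth (list_encode xs) i = xs ! i"
  unfolding list_code_nth_def list_code_drop by (simp add: Cons_nth_drop_Suc[symmetric])

lemma length_le_list_encode: "length xs \<le> list_encode xs"
proof (induction xs)
  case (Cons x xs)
  then show ?case using le_prod_encode_2[of "list_encode xs" x] by simp
qed simp

text \<open>Later used to bound the entries of an input by its code.\<close>

lemma mem_le_list_encode: "x \<in> set xs \<Longrightarrow> x \<le> list_encode xs"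
proof (induction xs)
  case (Cons y xs)
  then show ?case
    using le_prod_encode_2[of "list_encode xs" y] le_prod_encode_1[of y "list_encode xs"] by auto
qed simp

text \<open>A nonempty tail remains exactly at the indices below the length, and these are smaller
  than the code, at which the sum stops.\<close>

lemma list_code_length_encode: "list_code_length (list_encode xs) = length xs"
proof -
  have iff: "list_encode ys \<noteq> 0 \<longleftrightarrow> ys \<noteq> []" for ys by (cases ys) auto
  have "list_code_length (list_encode xs) = card {i \<in> {..<list_encode xs}. \<not> length xs \<le> i}"
    unfolding list_code_length_def list_code_drop iff of_bool_def
    by (subst sum.inter_filter[symmetric]) simp_all
  also have "{i \<in> {..<list_encode xs}. \<not> length xs \<le> i} = {..<length xs}"
    using length_le_list_encode[of xs] by auto
  finally show ?thesis by simp
qed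

lemma computable_list_code_drop:
  "computable f \<Longrightarrow> computable g \<Longrightarrow> computable (\<lambda>x. rec_nat (f x) (\<lambda>k r. psnd (r - 1)) (g x))"
  by (rule computable_rec)
     (assumption | intro computable_psnd computable_diff computable_id computable_const)+

lemma computable_list_code_nth:
  "computable f \<Longrightarrow> computable g \<Longrightarrow> computable (\<lambda>x. list_code_nth (f x) (g x))"
  unfolding list_code_nth_def
  by (intro computable_pfst computable_diff computable_list_code_drop computable_const)

lemma computable_list_code_length:
  assumes "computable f"
  shows "computable (\<lambda>x. list_code_length (f x))"
proof -
  have "decidable (\<lambda>p. rec_nat (f (pfst p)) (\<lambda>k r. psnd (r - 1)) (psnd p) \<noteq> 0)"
    by (intro decidable_not decidable_eq computable_list_code_drop computable_const
        computable_compose[OF assms] computable_pfst computable_psnd computable_id)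
  then show ?thesis
    unfolding list_code_length_def
    by (intro computable_sum assms) (simp add: decidable_def)
qed

lemmas computability_intros =
  computable_id computable_const computable_pfst computable_psnd computable_add computable_diff
  computable_mult computable_power computable_div computable_mod computable_list_code_nth
  computable_list_code_length computable_Suc
  decidable_not decidable_conj decidable_imp decidable_ball decidable_bex decidable_int_eq
  decidable_eq decidable_le decidable_less
  computable_int_decode computable_int_of_nat computable_int_diff computable_int_add
  computable_int_mult computable_int_sum

section \<open>Automata with an absorbing state\<close>

lemma foldl_in_closed:
  assumes "\<And>s a. s \<in> Q \<Longrightarrow> a \<in> A \<Longrightarrow> \<delta> s a \<in> Q" "s \<in> Q" "set w \<subseteq> A"
  shows "foldl \<delta> s w \<in> Q"
  using assms(2,3) by (induction w arbitrary: s) (auto simp: assms(1))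

lemma foldl_absorbing:
  assumes "\<And>a. a \<in> A \<Longrightarrow> \<delta> e a = e" "set w \<subseteq> A"
  shows "foldl \<delta> e w = e"
  using assms(2) by (induction w) (auto simp: assms(1))

text \<open>The first letter of a shortest word lowers the distance to \<open>e\<close> by exactly
  1, so all values below the distance of a state are distances of states. For \<open>p\<close>
  nearest to \<open>e\<close> in \<open>P\<close>, the states attaining the values below
  \<open>dist p\<close> are nearer than \<open>p\<close> and hence lie outside \<open>P\<close>;
  this leaves room for at most \<open>card Q - card P\<close> values.\<close>

lemma card_le_shortest_word:
  fixes \<delta> :: "'s \<Rightarrow> 'a \<Rightarrow> 's"
  assumes fin: "finite Q" and clos: "\<And>s a. s \<in> Q \<Longrightarrow> a \<in> A \<Longrightarrow> \<delta> s a \<in> Q"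
    and reach: "\<And>s. s \<in> Q \<Longrightarrow> \<exists>w. set w \<subseteq> A \<and> foldl \<delta> s w = e"
    and P: "P \<subseteq> Q" "P \<noteq> {}"
  shows "\<exists>p\<in>P. \<exists>w. set w \<subseteq> A \<and> foldl \<delta> p w = e \<and> length w + card P \<le> card Q"
proof -
  define word where "word = (\<lambda>s n. \<exists>w. set w \<subseteq> A \<and> length w = n \<and> foldl \<delta> s w = e)"
  define dist where "dist = (\<lambda>s. LEAST n. word s n)"
  have word_dist: "word s (dist s)" if "s \<in> Q" for s
    unfolding dist_def by (rule LeastI_ex) (use reach[OF that] in \<open>auto simp: word_def\<close>)
  have dist_le: "dist s \<le> n" if "word s n" for s n
    unfolding dist_def using that by (rule Least_le)
  have step: "\<exists>s'\<in>Q. dist s' = n" if s: "s \<in> Q" "dist s = Suc n" for s n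
  proof -
    obtain a w where w: "a \<in> A" "set w \<subseteq> A" "length w = n" "foldl \<delta> (\<delta> s a) w = e"
      using word_dist[OF s(1)] unfolding s(2) word_def by (auto simp: length_Suc_conv)
    have "word (\<delta> s a) n" using w(2-4) unfolding word_def by blast
    then have "dist (\<delta> s a) \<le> n" by (rule dist_le)
    moreover have Q': "\<delta> s a \<in> Q" using s(1) w(1) by (rule clos)
    moreover have "word s (Suc (dist (\<delta> s a)))"
    proof -
      obtain v where "set v \<subseteq> A" "length v = dist (\<delta> s a)" "foldl \<delta> (\<delta> s a) v = e"
        using word_dist[OF Q'] unfolding word_def by blast
      then show ?thesis using w(1) unfolding word_def by (intro exI[of _ "a # v"]) auto
    qed
    then have "Suc n \<le> Suc (dist (\<delta> s a))" using dist_le s(2) by metis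
    ultimately show ?thesis by (intro bexI[of _ "\<delta> s a"]) auto
  qed
  have surj: "\<exists>s'\<in>Q. dist s' = n" if "s \<in> Q" "n \<le> dist s" for s n
    using that
  proof (induction "dist s - n" arbitrary: s)
    case 0
    then show ?case by auto
  next
    case (Suc m)
    then obtain k where k: "dist s = Suc k" by (cases "dist s") auto
    obtain s' where "s' \<in> Q" "dist s' = k" using step[OF Suc.prems(1) k] by blast
    moreover have "m = k - n" "n \<le> k" using Suc.hyps(2) k by auto
    ultimately show ?case using Suc.hyps(1)[of s'] by simp
  qed
  obtain p where p: "p \<in> P" "\<And>p'. p' \<in> P \<Longrightarrow> dist p \<le> dist p'"
    using P(2) ex_has_least_nat[of "\<lambda>p. p \<in> P" _ dist] by blast
  define N where "N = {s \<in> Q. dist s < dist p}"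
  have "{..<dist p} \<subseteq> dist ` N"
  proof
    fix n assume "n \<in> {..<dist p}"
    then obtain s where "s \<in> Q" "dist s = n" using surj[of p n] p(1) P(1) by auto
    then show "n \<in> dist ` N" using \<open>n \<in> _\<close> by (auto simp: N_def)
  qed
  then have "dist p \<le> card N"
    using surj_card_le[of N "{..<dist p}" dist] fin by (simp add: N_def)
  moreover have "card N + card P = card (N \<union> P)"
    using fin P(1) p(2) by (intro card_Un_disjoint[symmetric]) (auto simp: N_def finite_subset dest: leD)
  moreover have "card (N \<union> P) \<le> card Q"
    using fin P(1) by (intro card_mono) (auto simp: N_def)
  moreover obtain w where "set w \<subseteq> A" "length w = dist p" "foldl \<delta> p w = e"
    using word_dist p(1) P(1) unfolding word_def by blast
  ultimately show ?thesis using p(1) by (intro bexI[of _ p] exI[of _ w]) auto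
qed

text \<open>Greedy synchronization: always send to the sink a remaining state that is nearest to it. All
  states on its way, except the sink, are states that do not remain.\<close>

lemma synchronizing_word:
  fixes \<delta> :: "'s \<Rightarrow> 'a \<Rightarrow> 's"
  assumes fin: "finite Q" and clos: "\<And>s a. s \<in> Q \<Longrightarrow> a \<in> A \<Longrightarrow> \<delta> s a \<in> Q"
    and e: "e \<in> Q" "\<And>a. a \<in> A \<Longrightarrow> \<delta> e a = e"
    and reach: "\<And>s. s \<in> Q \<Longrightarrow> \<exists>w. set w \<subseteq> A \<and> foldl \<delta> s w = e"
  shows "\<exists>w. set w \<subseteq> A \<and> length w \<le> card Q * (card Q - 1) div 2 \<and> (\<forall>s\<in>Q. foldl \<delta> s w = e)"
proof -
  \<comment> \<open>When \<open>i\<close> states other than \<open>e\<close> remain, the nearest of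
    them is at distance at most \<open>card Q - i\<close>; the sum collects these costs. States may
    merge on the way, so \<open>j\<close> is only an upper bound for the number of those that
    remain.\<close>
  have main: "\<exists>w. set w \<subseteq> A \<and> length w \<le> (\<Sum>i=1..j. card Q - i) \<and> (\<forall>s\<in>P. foldl \<delta> s w = e)"
    if "P \<subseteq> Q" "card (P - {e}) \<le> j" for P j
    using that
  proof (induction j arbitrary: P)
    case 0
    then have "P - {e} = {}" using fin finite_subset by (metis card_0_eq finite_Diff le_zero_eq)
    then show ?case by (intro exI[of _ "[]"]) auto
  next
    case (Suc j)
    show ?case
    proof (cases "card (P - {e}) \<le> j")
      case True
      then show ?thesis using Suc.IH[OF Suc.prems(1)] by (fastforce intro: order_trans)
    next
      case False
      then have card: "card (P - {e}) = Suc j" using Suc.prems(2) by simp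
      then have "P - {e} \<noteq> {}" by force
      then obtain p u where p: "p \<in> P - {e}" and u: "set u \<subseteq> A" "foldl \<delta> p u = e"
          "length u + card (P - {e}) \<le> card Q"
        using card_le_shortest_word[OF fin clos reach, of "P - {e}"] Suc.prems(1) by blast
      define P' where "P' = (\<lambda>s. foldl \<delta> s u) ` P"
      have P': "P' \<subseteq> Q" unfolding P'_def using foldl_in_closed[OF clos _ u(1)] Suc.prems(1) by auto
      have "P' - {e} \<subseteq> (\<lambda>s. foldl \<delta> s u) ` (P - {e} - {p})"
        using u(2) foldl_absorbing[of A \<delta> e u, OF e(2) u(1)] unfolding P'_def by auto
      moreover have finP: "finite (P - {e} - {p})" using fin Suc.prems(1) finite_subset by blast
      ultimately have "card (P' - {e}) \<le> card (P - {e} - {p})" by (rule surj_card_le[rotated])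
      also have "\<dots> = j" using card p by simp
      finally obtain v where v: "set v \<subseteq> A" "length v \<le> (\<Sum>i=1..j. card Q - i)"
          "\<forall>s\<in>P'. foldl \<delta> s v = e"
        using Suc.IH[OF P'] by blast
      show ?thesis
        using u v card by (intro exI[of _ "u @ v"]) (auto simp: P'_def)
    qed
  qed
  \<comment> \<open>As \<open>e\<close> lies in \<open>Q\<close>, at most \<open>card Q - 1\<close>
    states have to be absorbed, at costs \<open>card Q - 1, ..., 1\<close>.\<close>
  have "card (Q - {e}) \<le> card Q - 1" using e(1) by simp
  from main[OF order_refl this] obtain w where w: "set w \<subseteq> A"
      "length w \<le> (\<Sum>i=1..card Q - 1. card Q - i)" "\<forall>s\<in>Q. foldl \<delta> s w = e" by blast
  have "(\<Sum>i=1..n. Suc n - i) = Suc n * n div 2" for n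
  proof -
    have "(\<Sum>i=1..n. Suc n - i) = (\<Sum>i=1..n. i)"
      using sum.atLeastAtMost_rev[of "\<lambda>i. i" 1 n] by simp
    also have "\<dots> = Suc n * n div 2" using gauss_sum_from_Suc_0[of n, where 'a = nat] by (simp add: mult.commute)
    finally show ?thesis .
  qed
  from this[of "card Q - 1"] have "(\<Sum>i=1..card Q - 1. card Q - i) = card Q * (card Q - 1) div 2"
    using e(1) fin by (cases "card Q") auto
  then show ?thesis using w by auto
qed

definition unabsorbed :: "('s \<Rightarrow> 'a \<Rightarrow> 's) \<Rightarrow> 'a set \<Rightarrow> 's \<Rightarrow> 's \<Rightarrow> nat \<Rightarrow> 'a list set" where
  "unabsorbed \<delta> A e s n = {w. set w \<subseteq> A \<and> length w = n \<and> foldl \<delta> s w \<noteq> e}"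

text \<open>From every state of \<open>Q\<close>, at least one of the
  \<open>card A ^ length u\<close> continuations of length \<open>length u\<close>, namely
  \<open>u\<close>, is absorbed. Hence the fraction shrinks by a fixed factor \<open>t < 1\<close>
  over each such block. It is also decreasing, so it converges, and its limit satisfies
  \<open>b <= b * t\<close>.\<close>

lemma unabsorbed_fraction_tendsto_0:
  assumes A: "finite A" "A \<noteq> {}" and clos: "\<And>s a. s \<in> Q \<Longrightarrow> a \<in> A \<Longrightarrow> \<delta> s a \<in> Q"
    and e: "\<And>a. a \<in> A \<Longrightarrow> \<delta> e a = e"
    and u: "set u \<subseteq> A" "\<And>s. s \<in> Q \<Longrightarrow> foldl \<delta> s u = e" and s: "s \<in> Q"
  shows "(\<lambda>n. real (card (unabsorbed \<delta> A e s n)) / real (card A ^ n)) \<longlonglongrightarrow> 0"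
proof -
  let ?k = "card A" and ?B = "unabsorbed \<delta> A e s"
  have k: "?k > 0" using A by (simp add: card_gt_0_iff)
  have fin: "finite (?B n)" for n
    by (rule finite_subset[OF _ finite_lists_length_eq[OF A(1), of n]]) (auto simp: unabsorbed_def)
  \<comment> \<open>A prefix of an unabsorbed word is unabsorbed since \<open>e\<close> is
    absorbing, so each unabsorbed word splits into an unabsorbed word of length \<open>n\<close> and
    an element of \<open>V\<close>.\<close>
  have step: "card (?B (n + m)) \<le> card (?B n) * card V"
    if V: "V \<subseteq> {w. set w \<subseteq> A \<and> length w = m}"
      and bad: "\<And>w v. length w = n \<Longrightarrow> w @ v \<in> ?B (n + m) \<Longrightarrow> v \<in> V" for n m V
  proof -
    have finV: "finite V" by (rule finite_subset[OF V finite_lists_length_eq[OF A(1)]])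
    have sub: "?B (n + m) \<subseteq> (\<lambda>(w, v). w @ v) ` (?B n \<times> V)"
    proof
      fix x assume x: "x \<in> ?B (n + m)"
      let ?w = "take n x" and ?v = "drop n x"
      have "foldl \<delta> s x = foldl \<delta> (foldl \<delta> s ?w) ?v"
        by (metis append_take_drop_id foldl_append)
      then have len: "length ?w = n" "set ?w \<subseteq> A" "set ?v \<subseteq> A" "foldl \<delta> (foldl \<delta> s ?w) ?v \<noteq> e"
        using x set_take_subset[of n x] set_drop_subset[of n x] by (auto simp: unabsorbed_def)
      then have "foldl \<delta> s ?w \<noteq> e" using foldl_absorbing[of A \<delta> e, OF e len(3)] by metis
      then have "?w \<in> ?B n" using len by (simp add: unabsorbed_def)
      moreover have "?v \<in> V" using bad[of ?w ?v] len(1) x by simp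
      ultimately show "x \<in> (\<lambda>(w, v). w @ v) ` (?B n \<times> V)"
        by (intro image_eqI[of _ _ "(?w, ?v)"]) auto
    qed
    have "card (?B (n + m)) \<le> card (?B n \<times> V)"
      using surj_card_le[OF _ sub] fin finV by blast
    then show ?thesis by (simp add: card_cartesian_product)
  qed
  define x where "x = (\<lambda>n. real (card (?B n)) / real (?k ^ n))"
  define l where "l = length u"
  define V where "V = {w. set w \<subseteq> A \<and> length w = l} - {u}"
  have cardV: "card V = ?k ^ l - 1"
    using u(1) unfolding V_def l_def by (simp add: card_lists_length_eq A(1))
  have step_u: "card (?B (n + l)) \<le> card (?B n) * (?k ^ l - 1)" for n
    unfolding cardV[symmetric]
  proof (rule step)
    fix w v assume len: "length w = n" and wv: "w @ v \<in> ?B (n + l)"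
    have "set w \<subseteq> A" "set v \<subseteq> A" "length v = l" "foldl \<delta> (foldl \<delta> s w) v \<noteq> e"
      using wv len by (auto simp: unabsorbed_def)
    moreover from this have "foldl \<delta> s w \<in> Q"
      using foldl_in_closed[of Q A \<delta> s w] clos s by blast
    ultimately show "v \<in> V" using u(2) by (auto simp: V_def)
  qed (auto simp: V_def)
  have step_1: "card (?B (Suc n)) \<le> card (?B n) * ?k" for n
    using step[of "{w. set w \<subseteq> A \<and> length w = 1}" 1 n] card_lists_length_eq[OF A(1), of 1]
    by (auto simp: unabsorbed_def)
  have "decseq x"
  proof (rule decseq_SucI)
    fix n
    have "real (card (?B (Suc n))) \<le> real (card (?B n)) * real ?k"
      using of_nat_mono[OF step_1[of n], where 'a = real] by simp
    then show "x (Suc n) \<le> x n" unfolding x_def using k by (simp add: field_simps)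
  qed
  moreover have "x n \<ge> 0" for n by (simp add: x_def)
  ultimately obtain b where b: "x \<longlonglongrightarrow> b"
    using decseq_convergent[of x 0] by blast
  define t where "t = 1 - 1 / real (?k ^ l)"
  have "x (n + l) \<le> x n * t" for n
  proof -
    have kl: "?k ^ l \<ge> 1" using k by simp
    have "real (card (?B (n + l))) \<le> real (card (?B n) * (?k ^ l - 1))"
      using step_u[of n] by (rule of_nat_mono)
    also have "\<dots> = real (card (?B n)) * (real (?k ^ l) - 1)"
      using kl by (simp only: of_nat_mult of_nat_diff of_nat_1)
    finally have "real (card (?B (n + l))) \<le> real (card (?B n)) * (real (?k ^ l) - 1)" .
    then have "x (n + l) \<le> real (card (?B n)) * (real (?k ^ l) - 1) / real (?k ^ (n + l))"
      unfolding x_def by (intro divide_right_mono) auto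
    also have "\<dots> = x n * t" unfolding x_def t_def using k by (simp add: field_simps power_add)
    finally show ?thesis .
  qed
  moreover have "(\<lambda>n. x (n + l)) \<longlonglongrightarrow> b" using b by (rule LIMSEQ_ignore_initial_segment)
  moreover have "(\<lambda>n. x n * t) \<longlonglongrightarrow> b * t" using b by (intro tendsto_intros)
  ultimately have "b \<le> b * t" using LIMSEQ_le by blast
  then have "b / real (?k ^ l) \<le> 0" unfolding t_def by (simp add: right_diff_distrib)
  moreover have "real (?k ^ l) > 0" using k by simp
  ultimately have "b \<le> 0" by (simp only: divide_le_0_iff) linarith
  moreover have "b \<ge> 0" using LIMSEQ_le_const[OF b, of 0] \<open>\<And>n. x n \<ge> 0\<close> by simp
  ultimately show ?thesis using b unfolding x_def by simp
qed

section \<open>The carry automaton\<close>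

lemma vnorm_nonneg: "0 \<le> vnorm v"
  by (simp add: vnorm_def)

lemma vnorm_sq: "(vnorm v)\<^sup>2 = (\<Sum>i<dim_vec v. (v $ i)\<^sup>2)"
  by (simp add: vnorm_def L2_set_def sum_nonneg)

lemma vnorm_triangle:
  assumes "u \<in> carrier_vec n" "v \<in> carrier_vec n"
  shows "vnorm (u + v) \<le> vnorm u + vnorm v"
proof -
  have "vnorm (u + v) = L2_set (\<lambda>i. u $ i + v $ i) {..<n}"
    using assms unfolding vnorm_def by (intro L2_set_cong) auto
  then show ?thesis
    using L2_set_triangle_ineq[of "\<lambda>i. u $ i" "\<lambda>i. v $ i" "{..<n}"] assms by (simp add: vnorm_def)
qed

lemma vnorm_smult: "vnorm (c \<cdot>\<^sub>v v) = \<bar>c\<bar> * vnorm v"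
proof -
  have "vnorm (c \<cdot>\<^sub>v v) = sqrt (\<Sum>i<dim_vec v. c\<^sup>2 * (v $ i)\<^sup>2)"
    unfolding vnorm_def L2_set_def by (simp add: power_mult_distrib)
  also have "\<dots> = \<bar>c\<bar> * vnorm v"
    unfolding vnorm_def L2_set_def by (simp add: sum_distrib_left[symmetric] real_sqrt_mult)
  finally show ?thesis .
qed

lemma vnorm_uminus: "vnorm (- v) = vnorm v"
  unfolding vnorm_def by (simp add: L2_set_def)

lemma vnorm_minus:
  assumes "u \<in> carrier_vec n" "v \<in> carrier_vec n"
  shows "vnorm (u - v) \<le> vnorm u + vnorm v"
proof -
  have "u - v = u + (- v)" using assms by (intro eq_vecI) auto
  then show ?thesis using vnorm_triangle[of u n "- v"] assms by (simp add: vnorm_uminus)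
qed

lemma vnorm_zero [simp]: "vnorm (0\<^sub>v n) = 0"
  by (simp add: vnorm_def L2_set_def)

lemma vnorm_eq_0:
  assumes "v \<in> carrier_vec n" "vnorm v = 0"
  shows "v = 0\<^sub>v n"
  using assms by (intro eq_vecI) (auto simp: vnorm_def L2_set_eq_0_iff)

lemma abs_component_le_vnorm:
  assumes "i < dim_vec v"
  shows "\<bar>v $ i\<bar> \<le> vnorm v"
proof -
  have "\<bar>v $ i\<bar> \<le> L2_set (\<lambda>i. \<bar>v $ i\<bar>) {..<dim_vec v}"
    using assms by (intro member_le_L2_set) auto
  also have "\<dots> = vnorm v" unfolding vnorm_def L2_set_def by simp
  finally show ?thesis .
qed

abbreviation real_vec :: "int vec \<Rightarrow> real vec" where
  "real_vec \<equiv> map_vec real_of_int"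

lemma real_vec_add:
  "u \<in> carrier_vec n \<Longrightarrow> v \<in> carrier_vec n \<Longrightarrow> real_vec (u + v) = real_vec u + real_vec v"
  by (intro eq_vecI) auto

text \<open>A natural number: a strict decrease of the norm lowers it by at least 1, so descents
  terminate and their lengths can be counted.\<close>

definition sq_norm_nat :: "int vec \<Rightarrow> nat" where
  "sq_norm_nat z = nat (\<Sum>i<dim_vec z. (z $ i)\<^sup>2)"

lemma real_sq_norm_nat: "real (sq_norm_nat z) = (vnorm (real_vec z))\<^sup>2"
  by (simp add: sq_norm_nat_def vnorm_sq sum_nonneg)

lemma vec_add_diff_swap:
  fixes x y f g :: "'a :: ab_group_add vec"
  assumes "x \<in> carrier_vec n" "y \<in> carrier_vec n" "f \<in> carrier_vec n" "g \<in> carrier_vec n"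
  shows "x + f = y + g \<longleftrightarrow> f - g = y - x" "x - f = y \<longleftrightarrow> x = y + f"
proof -
  show "x + f = y + g \<longleftrightarrow> f - g = y - x"
    using assms by (auto simp: vec_eq_iff algebra_simps)
  show "x - f = y \<longleftrightarrow> x = y + f"
    using assms by (auto simp: vec_eq_iff algebra_simps)
qed

lemma vec_add_minus_cancel:
  fixes x f :: "'a :: ab_group_add vec"
  assumes "x \<in> carrier_vec n" "f \<in> carrier_vec n"
  shows "x + f - f = x"
  using assms by (auto simp: vec_eq_iff)

lemma mat_mult_zero_vec:
  fixes A :: "'a :: semiring_0 mat"
  assumes "A \<in> carrier_mat n m"
  shows "A *\<^sub>v 0\<^sub>v m = 0\<^sub>v n"
  using assms by (intro eq_vecI) (auto simp: scalar_prod_def)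

text \<open>The head is the least significant digit, because carries propagate upwards from there
  and \<open>foldl\<close> reads the head first.\<close>

primrec digit_value :: "nat \<Rightarrow> int mat \<Rightarrow> int vec list \<Rightarrow> int vec" where
  "digit_value d L [] = 0\<^sub>v d"
| "digit_value d L (f # w) = L *\<^sub>v digit_value d L w + f"

section \<open>Contraction by the inverse matrix, and carries\<close>

locale digit_system =
  fixes d :: nat and L :: "int mat" and F1 :: "int vec set"
  assumes adm: "admissible d L F1"
begin

lemma d_pos: "d \<ge> 1"
  and L_carrier [simp, intro]: "L \<in> carrier_mat d d"
  and expansion: "expansion_mat d (map_mat real_of_int L)"
  and finite_F1: "finite F1"
  and F1_carrier: "f \<in> F1 \<Longrightarrow> f \<in> carrier_vec d"
  and zero_in_F1: "0\<^sub>v d \<in> F1"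
  using adm unfolding admissible_def fundamental_domain_def by auto

definition LR :: "real mat" where "LR = map_mat real_of_int L"
definition M :: "real mat" where "M = real_inverse L"
definition q :: real where "q = opnorm M"
definition r :: real where "r = rbar L F1"

lemma LR_carrier [simp, intro]: "LR \<in> carrier_mat d d"
  by (simp add: LR_def)

lemma L_mult_carrier [simp, intro]: "L *\<^sub>v z \<in> carrier_vec d"
  by (rule carrier_vecI) (simp add: carrier_matD(1)[OF L_carrier])

text \<open>A kernel vector would contradict the expansion, so the determinant is nonzero and
  \<open>mat_inverse\<close> does return a matrix; this gives \<open>real_inverse\<close> its
  meaning.\<close>

lemma M_props: "M \<in> carrier_mat d d" "LR * M = 1\<^sub>m d" "M * LR = 1\<^sub>m d"
proof -
  have "det LR \<noteq> 0"
  proof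
    assume "det LR = 0"
    then obtain v where v: "v \<in> carrier_vec d" "v \<noteq> 0\<^sub>v d" "LR *\<^sub>v v = 0\<^sub>v d"
      using det_0_iff_vec_prod_zero_field[OF LR_carrier] by blast
    obtain c where c: "c > 1" "vnorm (LR *\<^sub>v v) > c * vnorm v"
      using expansion v unfolding expansion_mat_def LR_def by blast
    then show False using v(3) vnorm_nonneg[of v] by (simp add: mult_less_0_iff)
  qed
  then have "LR \<in> Units (ring_mat TYPE(real) d ())"
    by (intro det_non_zero_imp_unit) auto
  then obtain B where B: "mat_inverse LR = Some B"
    using mat_inverse(1)[OF LR_carrier, where b = "()"] by (cases "mat_inverse LR") auto
  then have "M = B" by (simp add: M_def real_inverse_def LR_def[symmetric])
  then show "M \<in> carrier_mat d d" "LR * M = 1\<^sub>m d" "M * LR = 1\<^sub>m d"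
    using mat_inverse(2)[OF LR_carrier B] by auto
qed

lemma M_carrier [simp, intro]: "M \<in> carrier_mat d d"
  by (rule M_props)

lemma M_mult_carrier [simp, intro]: "M *\<^sub>v v \<in> carrier_vec d"
  by (rule carrier_vecI) (simp add: carrier_matD(1)[OF M_carrier])

lemma LR_mult_carrier [simp, intro]: "LR *\<^sub>v v \<in> carrier_vec d"
  by (rule carrier_vecI) (simp add: carrier_matD(1)[OF LR_carrier])

lemma M_LR: "v \<in> carrier_vec d \<Longrightarrow> M *\<^sub>v (LR *\<^sub>v v) = v"
  using assoc_mult_mat_vec[OF M_carrier LR_carrier, of v] M_props(3) by simp

lemma LR_M: "v \<in> carrier_vec d \<Longrightarrow> LR *\<^sub>v (M *\<^sub>v v) = v"
  using assoc_mult_mat_vec[OF LR_carrier M_carrier, of v] M_props(2) by simp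

lemma real_vec_L: "z \<in> carrier_vec d \<Longrightarrow> real_vec (L *\<^sub>v z) = LR *\<^sub>v real_vec z"
  unfolding LR_def by (rule of_int_hom.mult_mat_vec_hom) auto

lemma M_bound:
  obtains b where "0 < b" "b < 1" "\<And>v. v \<in> carrier_vec d \<Longrightarrow> vnorm (M *\<^sub>v v) \<le> b * vnorm v"
proof -
  obtain c where c: "c > 1" "\<And>x. x \<in> carrier_vec d \<Longrightarrow> x \<noteq> 0\<^sub>v d \<Longrightarrow> vnorm (LR *\<^sub>v x) > c * vnorm x"
    using expansion unfolding expansion_mat_def LR_def by blast
  have "vnorm (M *\<^sub>v v) \<le> (1 / c) * vnorm v" if v: "v \<in> carrier_vec d" for v
  proof (cases "M *\<^sub>v v = 0\<^sub>v d")
    case True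
    then show ?thesis using c(1) vnorm_nonneg[of v] by simp
  next
    case False
    then show ?thesis using c(2)[of "M *\<^sub>v v"] LR_M[OF v] c(1) by (simp add: field_simps)
  qed
  then show thesis using c(1) by (intro that[of "1 / c"]) auto
qed

text \<open>The two conditions under which the supremum defining \<open>opnorm\<close> is a genuine
  one.\<close>

lemma opnorm_set:
  "bdd_above {vnorm (M *\<^sub>v v) |v. v \<in> carrier_vec (dim_col M) \<and> vnorm v \<le> 1}"
  "{vnorm (M *\<^sub>v v) |v. v \<in> carrier_vec (dim_col M) \<and> vnorm v \<le> 1} \<noteq> {}"
proof -
  have dim: "dim_col M = d" using M_carrier by blast
  obtain b where "0 < b" "\<And>v. v \<in> carrier_vec d \<Longrightarrow> vnorm (M *\<^sub>v v) \<le> b * vnorm v"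
    using M_bound by metis
  then have "vnorm (M *\<^sub>v v) \<le> b" if "v \<in> carrier_vec d" "vnorm v \<le> 1" for v
    using that by (metis mult.right_neutral mult_le_cancel_left_pos order_trans)
  then show "bdd_above {vnorm (M *\<^sub>v v) |v. v \<in> carrier_vec (dim_col M) \<and> vnorm v \<le> 1}"
    unfolding dim by (intro bdd_aboveI[of _ b]) auto
  show "{vnorm (M *\<^sub>v v) |v. v \<in> carrier_vec (dim_col M) \<and> vnorm v \<le> 1} \<noteq> {}"
    unfolding dim by (auto intro!: exI[of _ "0\<^sub>v d"])
qed

lemma q_le:
  assumes "\<And>v. v \<in> carrier_vec d \<Longrightarrow> vnorm (M *\<^sub>v v) \<le> b * vnorm v" "0 \<le> b"
  shows "q \<le> b"
proof -
  have dim: "dim_col M = d" using M_carrier by blast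
  have "vnorm (M *\<^sub>v v) \<le> b" if "v \<in> carrier_vec d" "vnorm v \<le> 1" for v
    using assms(1)[OF that(1)] mult_left_mono[OF that(2) assms(2)] by simp
  then show ?thesis
    unfolding q_def opnorm_def using opnorm_set(2) dim by (intro cSup_least) auto
qed

lemma q_nonneg: "0 \<le> q"
proof -
  have "dim_col M = d" using M_carrier by blast
  then have "vnorm (M *\<^sub>v 0\<^sub>v d) \<le> q"
    unfolding q_def opnorm_def by (intro cSup_upper[OF _ opnorm_set(1)]) (auto intro!: exI[of _ "0\<^sub>v d"])
  then show ?thesis using vnorm_nonneg order_trans by blast
qed

lemma q_less_1: "q < 1"
  using M_bound q_le by (metis less_imp_le order_le_less_trans)

lemma vnorm_M:
  assumes v: "v \<in> carrier_vec d"
  shows "vnorm (M *\<^sub>v v) \<le> q * vnorm v"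
proof (cases "vnorm v = 0")
  case True
  then have "v = 0\<^sub>v d" using vnorm_eq_0 v by blast
  moreover have "M *\<^sub>v 0\<^sub>v d = 0\<^sub>v d" by (rule mat_mult_zero_vec[OF M_carrier])
  ultimately show ?thesis by simp
next
  case False
  then have pos: "vnorm v > 0" using vnorm_nonneg[of v] by simp
  have dim: "dim_col M = d" using M_carrier by blast
  define u where "u = (1 / vnorm v) \<cdot>\<^sub>v v"
  have u: "u \<in> carrier_vec d" "vnorm u \<le> 1" using v pos by (auto simp: u_def vnorm_smult)
  then have "vnorm (M *\<^sub>v u) \<le> q"
    unfolding q_def opnorm_def dim using opnorm_set(1)[unfolded dim] by (intro cSup_upper) auto
  moreover have "M *\<^sub>v u = (1 / vnorm v) \<cdot>\<^sub>v (M *\<^sub>v v)"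
    unfolding u_def by (rule mult_mat_vec[OF M_carrier v])
  ultimately show ?thesis using pos by (simp add: vnorm_smult field_simps)
qed

text \<open>In this form \<open>r\<close> is visibly the fixed point of
  \<open>x \<mapsto> q * x + (1 - q) * r\<close>, where the last summand bounds the contribution of
  a digit.\<close>

lemma rho_eq: "set_norm ((\<lambda>f. M *\<^sub>v real_vec f) ` F1) = (1 - q) * r"
  using q_less_1 by (simp add: r_def rbar_def q_def M_def)

lemma vnorm_M_digit:
  assumes "f \<in> F1"
  shows "vnorm (M *\<^sub>v real_vec f) \<le> (1 - q) * r"
  unfolding rho_eq[symmetric] set_norm_def using assms finite_F1 by (intro Max_ge) auto

lemma r_nonneg: "0 \<le> r"
proof -
  have "0 \<le> (1 - q) * r" using vnorm_M_digit[OF zero_in_F1] vnorm_nonneg order_trans by blast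
  then show ?thesis using q_less_1 by (simp add: zero_le_mult_iff)
qed

text \<open>The difference \<open>f - g = L (b - a)\<close> puts both digits into one residue class,
  so they agree; then injectivity of \<open>L\<close> gives \<open>a = b\<close>.\<close>

lemma digit_unique:
  assumes "L *\<^sub>v a + f = L *\<^sub>v b + g" "f \<in> F1" "g \<in> F1" "a \<in> carrier_vec d" "b \<in> carrier_vec d"
  shows "a = b" "f = g"
proof -
  note c = F1_carrier[OF assms(2)] F1_carrier[OF assms(3)] assms(4,5)
  have "\<exists>!h. h \<in> F1 \<and> f - h \<in> (\<lambda>v. L *\<^sub>v v) ` carrier_vec d"
    using adm c(1) unfolding admissible_def fundamental_domain_def by blast
  moreover have "f - f \<in> (\<lambda>v. L *\<^sub>v v) ` carrier_vec d"
    using c(1) mat_mult_zero_vec[OF L_carrier] by (intro image_eqI[of _ _ "0\<^sub>v d"]) auto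
  moreover have "f - g \<in> (\<lambda>v. L *\<^sub>v v) ` carrier_vec d"
  proof (rule image_eqI)
    show "f - g = L *\<^sub>v (b - a)"
      using assms(1) vec_add_diff_swap(1)[of "L *\<^sub>v a" d "L *\<^sub>v b" f g] c
        mult_minus_distrib_mat_vec[OF L_carrier c(4,3)] by simp
  qed (use c in auto)
  ultimately show fg: "f = g" using assms(2,3) by blast
  have "L *\<^sub>v a = L *\<^sub>v a + f - f"
    using vec_add_minus_cancel[OF L_mult_carrier c(1), symmetric] .
  also have "L *\<^sub>v a + f = L *\<^sub>v b + f" using assms(1) unfolding fg .
  also have "L *\<^sub>v b + f - f = L *\<^sub>v b" by (rule vec_add_minus_cancel[OF L_mult_carrier c(1)])
  finally have "LR *\<^sub>v real_vec a = LR *\<^sub>v real_vec b"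
    using real_vec_L[OF c(3)] real_vec_L[OF c(4)] by metis
  then have "real_vec a = real_vec b"
    using M_LR[of "real_vec a"] M_LR[of "real_vec b"] c(3,4) map_carrier_vec by metis
  then show "a = b" using c(3,4) by (auto simp: vec_eq_iff)
qed

lemma ex_carry:
  assumes "z \<in> carrier_vec d"
  shows "\<exists>z'\<in>carrier_vec d. \<exists>f\<in>F1. z = L *\<^sub>v z' + f"
proof -
  obtain f where f: "f \<in> F1" "z - f \<in> (\<lambda>v. L *\<^sub>v v) ` carrier_vec d"
    using adm assms unfolding admissible_def fundamental_domain_def by blast
  then obtain z' where "z' \<in> carrier_vec d" "z - f = L *\<^sub>v z'" by blast
  moreover from this have "z = L *\<^sub>v z' + f"
    using vec_add_diff_swap(2)[of z d "L *\<^sub>v z'" f f] assms F1_carrier[OF f(1)] by simp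
  ultimately show ?thesis using f(1) by blast
qed

text \<open>Only the carry is kept, not the outgoing digit. By \<open>digit_unique\<close> there is
  no freedom in the choice, see \<open>step_unique\<close>.\<close>

definition step :: "int vec \<Rightarrow> int vec \<Rightarrow> int vec" where
  "step z f = (SOME z'. z' \<in> carrier_vec d \<and> (\<exists>f'\<in>F1. z + f = L *\<^sub>v z' + f'))"

lemma step_spec:
  assumes "z \<in> carrier_vec d" "f \<in> F1"
  obtains f' where "f' \<in> F1" "z + f = L *\<^sub>v step z f + f'" "step z f \<in> carrier_vec d"
proof -
  have "\<exists>z'. z' \<in> carrier_vec d \<and> (\<exists>f'\<in>F1. z + f = L *\<^sub>v z' + f')"
    using ex_carry[of "z + f"] assms F1_carrier by auto
  from someI_ex[OF this] show thesis using that unfolding step_def by blast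
qed

lemma step_carrier: "z \<in> carrier_vec d \<Longrightarrow> f \<in> F1 \<Longrightarrow> step z f \<in> carrier_vec d"
  using step_spec by metis

lemma run_carrier: "z \<in> carrier_vec d \<Longrightarrow> set w \<subseteq> F1 \<Longrightarrow> foldl step z w \<in> carrier_vec d"
  by (rule foldl_in_closed[of "carrier_vec d" F1 step]) (auto intro: step_carrier)

lemma step_unique:
  assumes "z \<in> carrier_vec d" "f \<in> F1" "z' \<in> carrier_vec d" "f' \<in> F1" "z + f = L *\<^sub>v z' + f'"
  shows "step z f = z'"
  using step_spec[OF assms(1,2)] digit_unique(1) assms(3-5) by metis

lemma step_zero: "f \<in> F1 \<Longrightarrow> step (0\<^sub>v d) f = 0\<^sub>v d"
  by (rule step_unique[of _ _ _ f]) (auto simp: F1_carrier mat_mult_zero_vec[OF L_carrier])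

text \<open>Division by \<open>L\<close> gives \<open>z' = M z - M f\<close>, and the digit costs at
  most \<open>(1 - q) * r\<close>.\<close>

lemma vnorm_carry:
  assumes z: "z \<in> carrier_vec d" "z' \<in> carrier_vec d" "f \<in> F1" and eq: "z = L *\<^sub>v z' + f"
  shows "vnorm (real_vec z') \<le> vnorm (M *\<^sub>v real_vec z) + (1 - q) * r"
proof -
  have f: "f \<in> carrier_vec d" using z(3) by (rule F1_carrier)
  have "real_vec z = LR *\<^sub>v real_vec z' + real_vec f"
    unfolding eq using real_vec_add[of "L *\<^sub>v z'" d f] real_vec_L z(2) f by simp
  then have "M *\<^sub>v real_vec z = real_vec z' + M *\<^sub>v real_vec f"
    using mult_add_distrib_mat_vec[OF M_carrier, of "LR *\<^sub>v real_vec z'" "real_vec f"] M_LR z(2) f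
    by simp
  then have "real_vec z' = M *\<^sub>v real_vec z - M *\<^sub>v real_vec f"
    using vec_add_minus_cancel[of "real_vec z'" d "M *\<^sub>v real_vec f"] z(2) by simp
  then have "vnorm (real_vec z') \<le> vnorm (M *\<^sub>v real_vec z) + vnorm (M *\<^sub>v real_vec f)"
    using vnorm_minus[of "M *\<^sub>v real_vec z" d "M *\<^sub>v real_vec f"] by simp
  then show ?thesis using vnorm_M_digit[OF z(3)] by simp
qed

lemma vnorm_step_zero:
  assumes "z \<in> carrier_vec d"
  shows "vnorm (real_vec (step z (0\<^sub>v d))) \<le> q * vnorm (real_vec z) + (1 - q) * r"
proof -
  obtain f' where "f' \<in> F1" "z = L *\<^sub>v step z (0\<^sub>v d) + f'" "step z (0\<^sub>v d) \<in> carrier_vec d"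
    using step_spec[OF assms zero_in_F1] assms by auto
  from vnorm_carry[OF assms this(3,1,2)] show ?thesis
    using vnorm_M[of "real_vec z"] assms by simp
qed

lemma vnorm_step:
  assumes "z \<in> carrier_vec d" "f \<in> F1"
  shows "vnorm (real_vec (step z f)) \<le> q * vnorm (real_vec z) + (1 - q) * (2 * r)"
proof -
  obtain f' where f': "f' \<in> F1" "z + f = L *\<^sub>v step z f + f'" "step z f \<in> carrier_vec d"
    using step_spec[OF assms] by metis
  have f: "f \<in> carrier_vec d" using assms(2) by (rule F1_carrier)
  have "M *\<^sub>v real_vec (z + f) = M *\<^sub>v real_vec z + M *\<^sub>v real_vec f"
    using real_vec_add[OF assms(1) f] mult_add_distrib_mat_vec[OF M_carrier, of "real_vec z" "real_vec f"]
      assms(1) f by simp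
  then have "vnorm (M *\<^sub>v real_vec (z + f)) \<le> q * vnorm (real_vec z) + (1 - q) * r"
    using vnorm_triangle[of "M *\<^sub>v real_vec z" d "M *\<^sub>v real_vec f"] vnorm_M[of "real_vec z"]
      vnorm_M_digit[OF assms(2)] assms(1) by simp
  then show ?thesis using vnorm_carry[of "z + f", OF _ f'(3,1,2)] assms(1) f by simp
qed

text \<open>An affine contraction with fixed point \<open>s\<close> moves everything beyond
  \<open>s\<close> strictly inwards. Its companion \<open>contraction_le\<close> says that it does
  not leave a ball of radius \<open>t >= s\<close>.\<close>

lemma contraction_less:
  assumes "x' \<le> q * x + (1 - q) * s" "s < x"
  shows "x' < x"
proof -
  have "(1 - q) * s < (1 - q) * x" using q_less_1 assms(2) by simp
  then show ?thesis using assms(1) by (simp add: algebra_simps)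
qed

lemma contraction_le:
  assumes "x' \<le> q * x + (1 - q) * s" "s \<le> t" "x \<le> t"
  shows "x' \<le> t"
proof -
  have "q * x \<le> q * t" "(1 - q) * s \<le> (1 - q) * t"
    using q_less_1 q_nonneg assms(2,3) by (simp_all add: mult_left_mono)
  then show ?thesis using assms(1) by (simp add: algebra_simps)
qed

lemma lattice_ballD: "z \<in> lattice_ball d s \<Longrightarrow> z \<in> carrier_vec d \<and> vnorm (real_vec z) \<le> s"
  by (simp add: lattice_ball_def)

lemma zero_in_ball: "0 \<le> s \<Longrightarrow> 0\<^sub>v d \<in> lattice_ball d s"
  by (auto simp: lattice_ball_def vnorm_def L2_set_def)

lemma step_in_ball:
  assumes "2 * r \<le> s" "z \<in> lattice_ball d s" "f \<in> F1"
  shows "step z f \<in> lattice_ball d s"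
  using contraction_le[OF vnorm_step assms(1)] step_carrier assms(2,3)
  by (auto simp: lattice_ball_def)

lemma run_in_ball:
  assumes "2 * r \<le> s" "z \<in> lattice_ball d s" "set w \<subseteq> F1"
  shows "foldl step z w \<in> lattice_ball d s"
  by (rule foldl_in_closed[of _ F1 step]) (use assms step_in_ball in auto)

text \<open>Outside the ball every step lowers the norm and hence \<open>\<mu>\<close>; once inside,
  the run stays there. The measure is left open because the steps are later counted by the absolute
  value in dimension 1 and by the squared norm otherwise.\<close>

lemma run_enters_ball:
  fixes \<mu> :: "int vec \<Rightarrow> nat"
  assumes \<mu>: "\<And>z z'. z \<in> carrier_vec d \<Longrightarrow> z' \<in> carrier_vec d \<Longrightarrow>
      vnorm (real_vec z') < vnorm (real_vec z) \<Longrightarrow> \<mu> z' < \<mu> z"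
    and "z \<in> carrier_vec d" "set w \<subseteq> F1"
  shows "foldl step z w \<in> lattice_ball d (2 * r) \<or> \<mu> (foldl step z w) + length w \<le> \<mu> z"
  using assms(2,3)
proof (induction w arbitrary: z)
  case (Cons f w)
  then have f: "f \<in> F1" "set w \<subseteq> F1" by auto
  have z': "step z f \<in> carrier_vec d" using Cons.prems(1) f(1) by (rule step_carrier)
  show ?case
  proof (cases "vnorm (real_vec z) \<le> 2 * r")
    case True
    then have "z \<in> lattice_ball d (2 * r)" using Cons.prems(1) by (simp add: lattice_ball_def)
    then show ?thesis using run_in_ball[OF order_refl _ Cons.prems(2)] by blast
  next
    case False
    then have "\<mu> (step z f) < \<mu> z"
      using \<mu>[OF Cons.prems(1) z'] contraction_less[OF vnorm_step[OF Cons.prems(1) f(1)]] by simp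
    then show ?thesis using Cons.IH[OF z' f(2)] by auto
  qed
qed simp

lemma sq_norm_nat_less:
  "vnorm (real_vec z') < vnorm (real_vec z) \<Longrightarrow> sq_norm_nat z' < sq_norm_nat z"
  using real_sq_norm_nat[of z'] real_sq_norm_nat[of z] vnorm_nonneg[of "real_vec z'"]
  by (metis of_nat_less_iff power_strict_mono zero_less_numeral)

text \<open>Reading only zeros leaves the outgoing digit as the sole contribution, so the descent
  continues down to radius \<open>r\<close> instead of \<open>2 * r\<close>.\<close>

lemma zero_run_enters_ball:
  assumes "z \<in> carrier_vec d"
  shows "\<exists>k. foldl step z (replicate k (0\<^sub>v d)) \<in> lattice_ball d r"
  using assms
proof (induction "sq_norm_nat z" arbitrary: z rule: less_induct)
  case less
  let ?z = "step z (0\<^sub>v d)"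
  have z': "?z \<in> carrier_vec d" using step_carrier[OF less.prems zero_in_F1] .
  show ?case
  proof (cases "vnorm (real_vec z) \<le> r")
    case True
    then show ?thesis using less.prems by (intro exI[of _ 0]) (simp add: lattice_ball_def)
  next
    case False
    then have "sq_norm_nat ?z < sq_norm_nat z"
      using sq_norm_nat_less contraction_less[OF vnorm_step_zero[OF less.prems]] by simp
    from less.hyps[OF this z'] obtain k where "foldl step ?z (replicate k (0\<^sub>v d)) \<in> lattice_ball d r" ..
    then show ?thesis by (intro exI[of _ "Suc k"]) simp
  qed
qed

end

section \<open>Lattice points in boxes and balls\<close>

lemma card_vec_box: "card {z :: int vec. dim_vec z = n \<and> (\<forall>i<n. \<bar>z $ i\<bar> \<le> int k)} = (2 * k + 1) ^ n"
  and finite_vec_box: "finite {z :: int vec. dim_vec z = n \<and> (\<forall>i<n. \<bar>z $ i\<bar> \<le> int k)}"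
proof -
  let ?B = "{z :: int vec. dim_vec z = n \<and> (\<forall>i<n. \<bar>z $ i\<bar> \<le> int k)}"
  let ?X = "{xs. set xs \<subseteq> {- int k..int k} \<and> length xs = n}"
  have "bij_betw vec_of_list ?X ?B"
  proof (rule bij_betw_byWitness[where f' = list_of_vec])
    show "vec_of_list ` ?X \<subseteq> ?B"
    proof clarsimp
      fix xs i assume "set xs \<subseteq> {- int k..int k}" "i < length xs"
      then have "xs ! i \<in> {- int k..int k}" using nth_mem by blast
      then show "\<bar>vec_of_list xs $ i\<bar> \<le> int k" using \<open>i < length xs\<close>
        by (auto simp: index_vec_of_list)
    qed
    show "list_of_vec ` ?B \<subseteq> ?X"
      by (auto simp: set_conv_nth list_of_vec_index abs_le_iff)
  qed (auto simp: list_vec vec_list)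
  moreover have "card ?X = (2 * k + 1) ^ n"
  proof -
    have "card {- int k..int k} = 2 * k + 1" by simp
    then show ?thesis using card_lists_length_eq[of "{- int k..int k}" n] by simp
  qed
  moreover have "finite ?X" by (rule finite_lists_length_eq) simp
  ultimately show "card ?B = (2 * k + 1) ^ n" "finite ?B"
    using bij_betw_same_card[of vec_of_list ?X ?B] bij_betw_finite[of vec_of_list ?X ?B] by auto
qed

lemma lattice_ball_subset_box:
  "lattice_ball n s \<subseteq> {z. dim_vec z = n \<and> (\<forall>i<n. \<bar>z $ i\<bar> \<le> int (nat \<lfloor>s\<rfloor>))}"
proof
  fix z assume z: "z \<in> lattice_ball n s"
  then have dim: "dim_vec z = n" and le: "vnorm (map_vec real_of_int z) \<le> s"
    by (auto simp: lattice_ball_def)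
  have "\<bar>z $ i\<bar> \<le> int (nat \<lfloor>s\<rfloor>)" if "i < n" for i
  proof -
    have "\<bar>real_of_int (z $ i)\<bar> \<le> s"
      using abs_component_le_vnorm[of i "real_vec z"] that dim le by simp
    then have "\<bar>z $ i\<bar> \<le> \<lfloor>s\<rfloor>" by (simp add: le_floor_iff)
    then show ?thesis by linarith
  qed
  then show "z \<in> {z. dim_vec z = n \<and> (\<forall>i<n. \<bar>z $ i\<bar> \<le> int (nat \<lfloor>s\<rfloor>))}" using dim by blast
qed

lemma finite_lattice_ball: "finite (lattice_ball n s)"
  using lattice_ball_subset_box finite_vec_box by (rule finite_subset)

lemma card_lattice_ball:
  assumes "0 \<le> s"
  shows "real (card (lattice_ball n s)) \<le> (2 * s + 1) ^ n"
proof -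
  have "card (lattice_ball n s) \<le> (2 * nat \<lfloor>s\<rfloor> + 1) ^ n"
    using card_mono[OF finite_vec_box lattice_ball_subset_box] unfolding card_vec_box .
  then have "real (card (lattice_ball n s)) \<le> real ((2 * nat \<lfloor>s\<rfloor> + 1) ^ n)" by (rule of_nat_mono)
  also have "\<dots> = (2 * real (nat \<lfloor>s\<rfloor>) + 1) ^ n" by (simp add: add.commute)
  also have "\<dots> \<le> (2 * s + 1) ^ n"
    using assms by (intro power_mono) auto
  finally show ?thesis .
qed

lemma incseq_subset_finite_eventually_const:
  fixes X :: "nat \<Rightarrow> 'a set"
  assumes "incseq X" "\<And>n. X n \<subseteq> B" "finite B"
  obtains N where "\<And>n. n \<ge> N \<Longrightarrow> X n = (\<Union>k. X k)"
proof -
  have fin: "finite (\<Union>k. X k)" by (rule finite_subset[OF _ assms(3)]) (use assms(2) in blast)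
  have "\<forall>x\<in>\<Union>k. X k. \<exists>n. x \<in> X n" by blast
  then obtain g where g: "\<And>x. x \<in> (\<Union>k. X k) \<Longrightarrow> x \<in> X (g x)" by metis
  define N where "N = Max (insert 0 (g ` (\<Union>k. X k)))"
  have "g x \<le> N" if "x \<in> (\<Union>k. X k)" for x
    unfolding N_def using fin that by (intro Max_ge) auto
  then have "(\<Union>k. X k) \<subseteq> X N" using g incseqD[OF assms(1)] by blast
  then have "X n = (\<Union>k. X k)" if "n \<ge> N" for n
    using incseqD[OF assms(1) that] by blast
  then show thesis by (rule that)
qed

section \<open>The Foelner property as reachability of the carry 0\<close>

context digit_system
begin

abbreviation words :: "nat \<Rightarrow> int vec list set" where
  "words n \<equiv> {w. set w \<subseteq> F1 \<and> length w = n}"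

lemma finite_words: "finite (words n)"
  and card_words: "card (words n) = card F1 ^ n"
  using finite_lists_length_eq[OF finite_F1] card_lists_length_eq[OF finite_F1] by auto

lemma digit_value_carrier: "set w \<subseteq> F1 \<Longrightarrow> digit_value d L w \<in> carrier_vec d"
  by (induction w) (auto simp: F1_carrier)

lemma F_seq_eq: "F_seq d L F1 n = digit_value d L ` words n"
proof (induction n)
  case (Suc n)
  have "F_seq d L F1 (Suc n) = {L *\<^sub>v digit_value d L w + f |w f. w \<in> words n \<and> f \<in> F1}"
    unfolding F_seq.simps Suc by (auto simp: set_plus_def)
  also have "\<dots> = digit_value d L ` words (Suc n)"
  proof (intro equalityI subsetI)
    fix x assume "x \<in> {L *\<^sub>v digit_value d L w + f |w f. w \<in> words n \<and> f \<in> F1}"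
    then obtain w f where "x = digit_value d L (f # w)" "w \<in> words n" "f \<in> F1" by auto
    then show "x \<in> digit_value d L ` words (Suc n)" by (intro image_eqI[of _ _ "f # w"]) auto
  next
    fix x assume "x \<in> digit_value d L ` words (Suc n)"
    then show "x \<in> {L *\<^sub>v digit_value d L w + f |w f. w \<in> words n \<and> f \<in> F1}"
      by (fastforce simp: length_Suc_conv)
  qed
  finally show ?case .
qed auto

lemma inj_digit_value: "inj_on (digit_value d L) (words n)"
proof (induction n)
  case (Suc n)
  show ?case
  proof (rule inj_onI)
    fix v w assume v: "v \<in> words (Suc n)" and w: "w \<in> words (Suc n)"
      and eq: "digit_value d L v = digit_value d L w"
    obtain f v' where v': "v = f # v'" "f \<in> F1" "v' \<in> words n" using v by (auto simp: length_Suc_conv)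
    obtain g w' where w': "w = g # w'" "g \<in> F1" "w' \<in> words n" using w by (auto simp: length_Suc_conv)
    have "digit_value d L v' \<in> carrier_vec d" "digit_value d L w' \<in> carrier_vec d"
      using v'(3) w'(3) digit_value_carrier by auto
    moreover have "L *\<^sub>v digit_value d L v' + f = L *\<^sub>v digit_value d L w' + g"
      using eq unfolding v'(1) w'(1) by simp
    ultimately have "digit_value d L v' = digit_value d L w'" "f = g"
      using digit_unique[OF _ v'(2) w'(2)] by blast+
    moreover from this(1) have "v' = w'" by (rule inj_onD[OF Suc _ v'(3) w'(3)])
    ultimately show "v = w" unfolding v'(1) w'(1) by simp
  qed
qed (auto simp: inj_on_def)

lemma F_seq_carrier: "x \<in> F_seq d L F1 n \<Longrightarrow> x \<in> carrier_vec d"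
  unfolding F_seq_eq using digit_value_carrier by auto

lemma finite_F_seq: "finite (F_seq d L F1 n)"
  unfolding F_seq_eq using finite_words by simp

lemma card_F_seq: "card (F_seq d L F1 n) = card F1 ^ n"
  unfolding F_seq_eq by (simp add: card_image[OF inj_digit_value] card_words)

lemma card_F1_pos: "card F1 > 0"
  using finite_F1 zero_in_F1 by (auto simp: card_gt_0_iff)

text \<open>If \<open>y\<close> is the value of \<open>w\<close>, then
  \<open>z + (L y + f) = L (step z f + y) + f'\<close>. By uniqueness of digits, membership passes
  to \<open>step z f + y\<close>, one level lower; at the bottom the set is
  \<open>{0}\<close>.\<close>

lemma add_mem_F_seq_iff:
  assumes "z \<in> carrier_vec d" "set w \<subseteq> F1"
  shows "z + digit_value d L w \<in> F_seq d L F1 (length w) \<longleftrightarrow> foldl step z w = 0\<^sub>v d"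
  using assms
proof (induction w arbitrary: z)
  case (Cons f w)
  let ?y = "digit_value d L w"
  have f: "f \<in> F1" "f \<in> carrier_vec d" and w: "set w \<subseteq> F1" and y: "?y \<in> carrier_vec d"
    using Cons.prems(2) F1_carrier digit_value_carrier by auto
  obtain f' where f': "f' \<in> F1" "z + f = L *\<^sub>v step z f + f'" and z': "step z f \<in> carrier_vec d"
    using step_spec[OF Cons.prems(1) f(1)] by metis
  have f'c: "f' \<in> carrier_vec d" using f'(1) by (rule F1_carrier)
  have comm: "a + (u + b) = (a + b) + u" "(a + b) + u = (a + u) + b"
    if "a \<in> carrier_vec d" "b \<in> carrier_vec d" "u \<in> carrier_vec d" for a b u :: "int vec"
    using that by (auto simp: vec_eq_iff)
  have "z + digit_value d L (f # w) = (z + f) + L *\<^sub>v ?y"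
    using comm(1)[OF Cons.prems(1) f(2) L_mult_carrier] by simp
  also have "\<dots> = L *\<^sub>v (step z f + ?y) + f'"
    unfolding f'(2) mult_add_distrib_mat_vec[OF L_carrier z' y]
    using comm(2)[OF L_mult_carrier f'c L_mult_carrier] by simp
  finally have eq: "z + digit_value d L (f # w) = L *\<^sub>v (step z f + ?y) + f'" .
  have "z + digit_value d L (f # w) \<in> F_seq d L F1 (length (f # w)) \<longleftrightarrow>
    step z f + ?y \<in> F_seq d L F1 (length w)"
  proof
    assume "z + digit_value d L (f # w) \<in> F_seq d L F1 (length (f # w))"
    then obtain x g where x: "x \<in> F_seq d L F1 (length w)" "g \<in> F1"
        "L *\<^sub>v (step z f + ?y) + f' = L *\<^sub>v x + g"
      unfolding eq by (auto simp: set_plus_def)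
    then have "step z f + ?y = x"
      using digit_unique(1)[OF x(3) f'(1) x(2)] z' y F_seq_carrier[OF x(1)] by simp
    then show "step z f + ?y \<in> F_seq d L F1 (length w)" using x(1) by simp
  next
    assume "step z f + ?y \<in> F_seq d L F1 (length w)"
    then show "z + digit_value d L (f # w) \<in> F_seq d L F1 (length (f # w))"
      unfolding eq using f'(1) by (auto simp: set_plus_def)
  qed
  then show ?case using Cons.IH[OF z' w] by simp
qed auto

text \<open>Unabsorbed words parametrize the points of the translate outside \<open>F_n\<close>. The
  other half of the symmetric difference has the same size, since translation preserves
  cardinality.\<close>

lemma card_sym_diff_F_seq:
  assumes m: "m \<in> carrier_vec d"
  shows "card (sym_diff (F_seq d L F1 n) ({m} + F_seq d L F1 n)) =
    2 * card (unabsorbed step F1 (0\<^sub>v d) m n)"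
proof -
  let ?F = "F_seq d L F1 n" and ?U = "unabsorbed step F1 (0\<^sub>v d) m n"
  have shift: "{m} + ?F = (\<lambda>x. m + x) ` ?F" by (auto simp: set_plus_def)
  have inj: "inj_on (\<lambda>x. m + x) ?F"
  proof (rule inj_onI)
    fix x y assume "x \<in> ?F" "y \<in> ?F" "m + x = m + y"
    then show "x = y" using F_seq_carrier m by (auto simp: vec_eq_iff)
  qed
  have cardm: "card ({m} + ?F) = card ?F" unfolding shift by (rule card_image[OF inj])
  have fin: "finite ?F" "finite ({m} + ?F)" using finite_F_seq unfolding shift by auto
  have "card (({m} + ?F) - ?F) + card (({m} + ?F) \<inter> ?F) = card ({m} + ?F)"
    "card (?F - ({m} + ?F)) + card (({m} + ?F) \<inter> ?F) = card ?F"
    using fin by (simp_all add: card_Diff_subset_Int Int_commute card_mono)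
  then have eq: "card (?F - ({m} + ?F)) = card (({m} + ?F) - ?F)" using cardm by linarith
  have "({m} + ?F) - ?F = (\<lambda>w. m + digit_value d L w) ` ?U"
  proof (intro equalityI subsetI)
    fix x assume x: "x \<in> ({m} + ?F) - ?F"
    then have "x \<in> (\<lambda>x. m + x) ` digit_value d L ` words n" unfolding shift unfolding F_seq_eq by blast
    then obtain w where w: "w \<in> words n" "x = m + digit_value d L w" by blast
    then have "w \<in> ?U" using x add_mem_F_seq_iff[OF m, of w] by (auto simp: unabsorbed_def)
    then show "x \<in> (\<lambda>w. m + digit_value d L w) ` ?U" using w(2) by blast
  next
    fix x assume "x \<in> (\<lambda>w. m + digit_value d L w) ` ?U"
    then obtain w where w: "w \<in> ?U" "x = m + digit_value d L w" by blast
    then have "w \<in> words n" by (simp add: unabsorbed_def)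
    then have "x \<in> {m} + ?F" unfolding shift unfolding F_seq_eq using w(2) by blast
    moreover have "x \<notin> ?F" using w add_mem_F_seq_iff[OF m, of w] by (auto simp: unabsorbed_def)
    ultimately show "x \<in> ({m} + ?F) - ?F" by blast
  qed
  moreover have "inj_on (\<lambda>w. m + digit_value d L w) ?U"
  proof -
    have "?U \<subseteq> words n" by (auto simp: unabsorbed_def)
    then have "inj_on (digit_value d L) ?U" "digit_value d L ` ?U \<subseteq> ?F"
      using inj_on_subset[OF inj_digit_value] unfolding F_seq_eq by blast+
    then have "inj_on ((\<lambda>x. m + x) \<circ> digit_value d L) ?U"
      by (intro comp_inj_on inj_on_subset[OF inj])
    then show ?thesis by (simp add: comp_def)
  qed
  ultimately have "card (({m} + ?F) - ?F) = card ?U" by (simp add: card_image)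
  moreover have "card (sym_diff ?F ({m} + ?F)) = card (?F - ({m} + ?F)) + card (({m} + ?F) - ?F)"
    using fin by (intro card_Un_disjoint) auto
  ultimately show ?thesis using eq by simp
qed

text \<open>The radius \<open>2 * r\<close> serves the length bound; larger ones are needed for the
  Foelner property, where the ball has to contain a given translation vector.\<close>

lemma synchronizing_word_ball:
  assumes s: "2 * r \<le> s"
    and reach: "\<And>z. z \<in> carrier_vec d \<Longrightarrow> \<exists>w. set w \<subseteq> F1 \<and> foldl step z w = 0\<^sub>v d"
  shows "\<exists>w. set w \<subseteq> F1 \<and>
    length w \<le> card (lattice_ball d s) * (card (lattice_ball d s) - 1) div 2 \<and>
    (\<forall>z\<in>lattice_ball d s. foldl step z w = 0\<^sub>v d)"
proof (rule synchronizing_word[OF finite_lattice_ball])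
  show "step z f \<in> lattice_ball d s" if "z \<in> lattice_ball d s" "f \<in> F1" for z f
    using step_in_ball[OF s that] .
  show "0\<^sub>v d \<in> lattice_ball d s" using zero_in_ball r_nonneg s by simp
  show "\<exists>w. set w \<subseteq> F1 \<and> foldl step z w = 0\<^sub>v d" if "z \<in> lattice_ball d s" for z
    using reach lattice_ballD[OF that] by blast
qed (auto simp: step_zero)

text \<open>The Foelner ratio is twice the fraction of unabsorbed words. That fraction is constantly
  1 if 0 is unreachable from \<open>z\<close>, and tends to 0 if a synchronizing word
  exists.\<close>

lemma folner_iff_reach:
  "folner d (F_seq d L F1) \<longleftrightarrow>
    (\<forall>z\<in>carrier_vec d. \<exists>w. set w \<subseteq> F1 \<and> foldl step z w = 0\<^sub>v d)"
proof -
  define x where "x = (\<lambda>m n. real (card (unabsorbed step F1 (0\<^sub>v d) m n)) / real (card F1 ^ n))"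
  have ratio: "real (card (sym_diff (F_seq d L F1 n) ({m} + F_seq d L F1 n))) / real (card (F_seq d L F1 n))
      = 2 * x m n" if "m \<in> carrier_vec d" for m n
    using card_sym_diff_F_seq[OF that] card_F_seq by (simp add: x_def)
  show ?thesis
  proof (intro iffI ballI)
    fix z :: "int vec" assume fol: "folner d (F_seq d L F1)" and z: "z \<in> carrier_vec d"
    show "\<exists>w. set w \<subseteq> F1 \<and> foldl step z w = 0\<^sub>v d"
    proof (rule ccontr)
      assume "\<not> ?thesis"
      then have "unabsorbed step F1 (0\<^sub>v d) z n = words n" for n by (auto simp: unabsorbed_def)
      then have "x z n = 1" for n using card_words card_F1_pos by (simp add: x_def)
      moreover have "(\<lambda>n. 2 * x z n) \<longlonglongrightarrow> 0"
        using fol z unfolding folner_def ratio[OF z, symmetric] by blast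
      ultimately have "(\<lambda>n. 2 :: real) \<longlonglongrightarrow> 0" by simp
      then show False by (simp add: LIMSEQ_const_iff)
    qed
  next
    assume reach: "\<forall>z\<in>carrier_vec d. \<exists>w. set w \<subseteq> F1 \<and> foldl step z w = 0\<^sub>v d"
    have "(\<lambda>n. 2 * x m n) \<longlonglongrightarrow> 0" if m: "m \<in> carrier_vec d" for m
    proof -
      \<comment> \<open>Large enough to contain \<open>m\<close>, and at least \<open>2 * r\<close>
        so that the ball is closed under \<open>step\<close>.\<close>
      define s where "s = max (2 * r) (vnorm (real_vec m))"
      have s: "2 * r \<le> s" and ms: "m \<in> lattice_ball d s" using m by (auto simp: s_def lattice_ball_def)
      obtain u where u: "set u \<subseteq> F1" "\<And>z. z \<in> lattice_ball d s \<Longrightarrow> foldl step z u = 0\<^sub>v d"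
        using synchronizing_word_ball[OF s] reach by blast
      have "(\<lambda>n. x m n) \<longlonglongrightarrow> 0"
        unfolding x_def
        by (rule unabsorbed_fraction_tendsto_0[where Q = "lattice_ball d s" and u = u])
           (use finite_F1 zero_in_F1 step_in_ball[OF s] step_zero u ms in auto)
      then show ?thesis using tendsto_mult_right_zero by blast
    qed
    then show "folner d (F_seq d L F1)" unfolding folner_def using ratio by simp
  qed
qed

end

section \<open>The bound on the length\<close>

lemma vnorm_mono:
  assumes "dim_vec u = dim_vec v" "\<And>i. i < dim_vec v \<Longrightarrow> \<bar>u $ i\<bar> \<le> \<bar>v $ i\<bar>"
  shows "vnorm u \<le> vnorm v"
proof -
  have "(\<Sum>i<dim_vec v. (u $ i)\<^sup>2) \<le> (\<Sum>i<dim_vec v. (v $ i)\<^sup>2)"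
    using assms(2) by (intro sum_mono) (simp add: abs_le_square_iff)
  then show ?thesis unfolding vnorm_def L2_set_def assms(1) by (rule real_sqrt_le_mono)
qed

text \<open>With \<open>M = (6r)\<^sup>d \<ge> N\<close>, the right-hand side exceeds \<open>M(M - 1)/2\<close> by \<open>M(M - 1)(M - 2)/6\<close>, which
  leaves room for the steps counted by \<open>T\<close>. For \<open>d = 1\<close> and \<open>r = 1/2\<close> there is equality.\<close>

lemma length_bound:
  fixes r :: real and N T d :: nat
  assumes r: "1 / 2 \<le> r" and d: "d \<ge> 1" and N: "real N \<le> (4 * r + 1) ^ d"
    and T1: "d = 1 \<Longrightarrow> T = nat \<lfloor>4 * r\<rfloor> - nat \<lfloor>2 * r\<rfloor>"
    and T2: "d \<ge> 2 \<Longrightarrow> real T \<le> 12 * r\<^sup>2 + 1"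
  shows "real (T + N * (N - 1) div 2) \<le> ((6 * r) ^ (3 * d) - (6 * r) ^ d) / 6"
proof -
  define M where "M = (6 * r) ^ d"
  have M3: "3 \<le> M"
  proof -
    have "(3::real) ^ 1 \<le> 3 ^ d" using d by (intro power_increasing) auto
    also have "\<dots> \<le> M" unfolding M_def using r by (intro power_mono) auto
    finally show ?thesis by simp
  qed
  have NM: "real N \<le> M"
  proof -
    have "(4 * r + 1) ^ d \<le> M" unfolding M_def using r by (intro power_mono) auto
    then show ?thesis using N by simp
  qed
  have T: "real T \<le> M * ((M - 1) * (M - 2)) / 6"
  proof (cases "d = 1")
    case True
    then have M: "M = 6 * r" by (simp add: M_def)
    \<comment> \<open>The estimate \<open>T <= M / 3 + 1\<close> is too weak near
      \<open>r = 1 / 2\<close>, where the right-hand side is just 1; for \<open>r < 3 / 4\<close>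
      the floors give \<open>T <= 1\<close>.\<close>
    show ?thesis
    proof (cases "r < 3 / 4")
      case True
      then have "\<lfloor>4 * r\<rfloor> \<le> 2" "\<lfloor>2 * r\<rfloor> \<ge> 1" using r by linarith+
      then have "real T \<le> 1" using T1[OF \<open>d = 1\<close>] by linarith
      moreover have "3 * (2 * 1) \<le> M * ((M - 1) * (M - 2))"
        using M3 by (intro mult_mono) auto
      ultimately show ?thesis by simp
    next
      case False
      then have "real T \<le> M / 3 + 1" using T1[OF \<open>d = 1\<close>] M by linarith
      moreover have "M * (7 / 2 * (5 / 2)) \<le> M * ((M - 1) * (M - 2))"
        using False M by (intro mult_mono mult_left_mono) auto
      ultimately show ?thesis using False M by linarith
    qed
  next
    case False
    then have d2: "d \<ge> 2" using d by simp
    \<comment> \<open>This turns the quadratic bound on \<open>T\<close> into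
      \<open>T <= M / 3 + 1\<close>, far below the cubic right-hand side once
      \<open>M >= 9\<close>.\<close>
    have "(6 * r)\<^sup>2 \<le> M" unfolding M_def using r d2 by (intro power_increasing) auto
    then have M36: "36 * r\<^sup>2 \<le> M" by (simp add: power_mult_distrib)
    have "(1 / 2)\<^sup>2 \<le> r\<^sup>2" using r by (intro power_mono) auto
    then have M9: "9 \<le> M" using M36 by (simp add: power2_eq_square)
    have "M * (8 * 7) \<le> M * ((M - 1) * (M - 2))"
      using M9 by (intro mult_mono mult_left_mono) auto
    then show ?thesis using T2[OF d2] M36 M9 by linarith
  qed
  have half: "real (N * (N - 1) div 2) \<le> M * (M - 1) / 2"
  proof (cases "N = 0")
    case False
    have "real (a div 2) \<le> real a / 2" for a :: nat
      by (cases "even a") (auto elim!: evenE oddE)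
    then have "real (N * (N - 1) div 2) \<le> real (N * (N - 1)) / 2" .
    also have "real (N * (N - 1)) = real N * (real N - 1)" using False by (simp add: of_nat_diff)
    also have "\<dots> \<le> M * (M - 1)" using NM False by (intro mult_mono) auto
    finally show ?thesis by simp
  qed (use M3 in simp)
  have "real (T + N * (N - 1) div 2) \<le> M * ((M - 1) * (M - 2)) / 6 + M * (M - 1) / 2"
    using T half by simp
  also have "\<dots> = (M ^ 3 - M) / 6" by (simp add: field_simps power3_eq_cube)
  also have "M ^ 3 = (6 * r) ^ (3 * d)" 
    using power_mult[of "6 * r" d 3] by (simp only: M_def mult.commute)
  finally show ?thesis unfolding M_def .
qed

context digit_system
begin

text \<open>The point \<open>p\<close> with all coordinates \<open>1/2\<close> has the maximal distance to the lattice; compare it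
  with the lattice point \<open>w\<close> for which \<open>L p\<close> is close to \<open>L w + F\<^sub>1\<close>.\<close>

lemma half_le_r: "1 / 2 \<le> r"
proof -
  define p :: "real vec" where "p = vec d (\<lambda>_. 1 / 2)"
  \<comment> \<open>The rounding error is at most \<open>1 / 2\<close> in each coordinate, so its
    norm does not exceed that of \<open>p\<close>.\<close>
  define z :: "int vec" where "z = vec d (\<lambda>i. round ((LR *\<^sub>v p) $ i))"
  have p: "p \<in> carrier_vec d" and z: "z \<in> carrier_vec d" by (simp_all add: p_def z_def)
  obtain w f where w: "w \<in> carrier_vec d" and f: "f \<in> F1" and zw: "z = L *\<^sub>v w + f"
    using ex_carry[OF z] by blast
  have fc: "f \<in> carrier_vec d" using f by (rule F1_carrier)
  define u where "u = LR *\<^sub>v p - real_vec z"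
  have u: "u \<in> carrier_vec d" by (simp add: u_def z)
  have dims: "dim_vec (LR *\<^sub>v p) = d" using LR_mult_carrier[of p] by (rule carrier_vecD)
  have "\<bar>u $ i\<bar> \<le> \<bar>p $ i\<bar>" if "i < d" for i
    using of_int_round_abs_le[of "(LR *\<^sub>v p) $ i"] that dims by (simp add: u_def p_def z_def abs_minus_commute)
  then have unorm: "vnorm u \<le> vnorm p" using u p by (intro vnorm_mono) auto
  have minus_add: "a - b = a - (b + c) + c"
    if "a \<in> carrier_vec d" "b \<in> carrier_vec d" "c \<in> carrier_vec d" for a b c :: "real vec"
    using that by (auto simp: vec_eq_iff)
  have "real_vec z = LR *\<^sub>v real_vec w + real_vec f"
    unfolding zw using real_vec_add[OF L_mult_carrier fc] real_vec_L[OF w] by simp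
  then have "LR *\<^sub>v (p - real_vec w) = u + real_vec f"
    unfolding u_def using mult_minus_distrib_mat_vec[OF LR_carrier p, of "real_vec w"] w
      minus_add[OF LR_mult_carrier LR_mult_carrier, of "real_vec f" p "real_vec w"] fc by simp
  then have "p - real_vec w = M *\<^sub>v (u + real_vec f)"
    using M_LR[of "p - real_vec w"] p w by simp
  also have "\<dots> = M *\<^sub>v u + M *\<^sub>v real_vec f"
    by (rule mult_add_distrib_mat_vec[OF M_carrier u]) (simp add: fc)
  finally have "vnorm (p - real_vec w) \<le> vnorm (M *\<^sub>v u) + vnorm (M *\<^sub>v real_vec f)"
    using vnorm_triangle[OF M_mult_carrier M_mult_carrier] by simp
  also have "\<dots> \<le> q * vnorm p + (1 - q) * r"
    using vnorm_M[OF u] vnorm_M_digit[OF f] mult_left_mono[OF unorm q_nonneg] by linarith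
  finally have "vnorm (p - real_vec w) \<le> q * vnorm p + (1 - q) * r" .
  \<comment> \<open>Every integer has distance at least \<open>1 / 2\<close> from
    \<open>1 / 2\<close>. Both estimates together yield
    \<open>vnorm p <= q * vnorm p + (1 - q) * r\<close>.\<close>
  moreover have "vnorm p \<le> vnorm (p - real_vec w)"
  proof (rule vnorm_mono)
    fix i assume i: "i < dim_vec (p - real_vec w)"
    have "w $ i \<le> 0 \<or> w $ i \<ge> 1" by linarith
    then have "real_of_int (w $ i) \<le> 0 \<or> real_of_int (w $ i) \<ge> 1" by simp
    then have "1 / 2 \<le> \<bar>1 / 2 - real_of_int (w $ i)\<bar>" by linarith
    then show "\<bar>p $ i\<bar> \<le> \<bar>(p - real_vec w) $ i\<bar>" using i w by (simp add: p_def)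
  qed (use p w in simp)
  ultimately have "(1 - q) * vnorm p \<le> (1 - q) * r" by (simp add: algebra_simps)
  then have "vnorm p \<le> r" using q_less_1 by simp
  moreover have "1 / 2 \<le> vnorm p"
    using abs_component_le_vnorm[of 0 p] d_pos by (simp add: p_def)
  ultimately show ?thesis by simp
qed

text \<open>In \<open>L z + h = c + f + g\<close> the three digits cost \<open>(1 - q) * r\<close>
  each, so \<open>3 * r\<close> is the fixed point of the estimate.\<close>

lemma C_seq_subset_ball: "C_seq d L F1 n \<subseteq> lattice_ball d (3 * r)"
proof (induction n)
  case 0
  then show ?case using zero_in_ball r_nonneg by simp
next
  case (Suc n)
  show ?case
  proof
    fix z assume "z \<in> C_seq d L F1 (Suc n)"
    then obtain c f g h where z: "z \<in> carrier_vec d" and c: "c \<in> C_seq d L F1 n"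
        and fgh: "f \<in> F1" "g \<in> F1" "h \<in> F1" and eq: "L *\<^sub>v z = c + f + g + - h"
      by (auto simp: set_plus_def)
    have cb: "c \<in> carrier_vec d" "vnorm (real_vec c) \<le> 3 * r"
      using Suc c lattice_ballD by auto
    note fc = F1_carrier[OF fgh(1)] F1_carrier[OF fgh(2)]
    have "c + f + g = L *\<^sub>v z + h"
      unfolding eq using cb fc F1_carrier[OF fgh(3)] by (auto simp: vec_eq_iff)
    from vnorm_carry[OF _ z fgh(3) this]
    have "vnorm (real_vec z) \<le> vnorm (M *\<^sub>v real_vec (c + f + g)) + (1 - q) * r"
      using cb fc by simp
    moreover have "M *\<^sub>v real_vec (c + f + g) = M *\<^sub>v real_vec c + M *\<^sub>v real_vec f + M *\<^sub>v real_vec g"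
    proof -
      have "real_vec (c + f + g) = real_vec c + real_vec f + real_vec g"
        using real_vec_add[of "c + f" d g] real_vec_add[of c d f] cb fc by simp
      then show ?thesis
        using mult_add_distrib_mat_vec[OF M_carrier, of "real_vec c + real_vec f" "real_vec g"]
          mult_add_distrib_mat_vec[OF M_carrier, of "real_vec c" "real_vec f"] cb fc by simp
    qed
    moreover have "vnorm (M *\<^sub>v real_vec c + M *\<^sub>v real_vec f + M *\<^sub>v real_vec g) \<le>
        vnorm (M *\<^sub>v real_vec c) + vnorm (M *\<^sub>v real_vec f) + vnorm (M *\<^sub>v real_vec g)"
      using vnorm_triangle[of "M *\<^sub>v real_vec c + M *\<^sub>v real_vec f" d "M *\<^sub>v real_vec g"]
        vnorm_triangle[of "M *\<^sub>v real_vec c" d "M *\<^sub>v real_vec f"] by simp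
    ultimately have "vnorm (real_vec z) \<le> q * vnorm (real_vec c) + (1 - q) * (3 * r)"
      using vnorm_M[of "real_vec c"] cb(1) vnorm_M_digit[OF fgh(1)] vnorm_M_digit[OF fgh(2)] by simp
    then have "vnorm (real_vec z) \<le> 3 * r" using contraction_le[OF _ order_refl cb(2)] by simp
    then show "z \<in> lattice_ball d (3 * r)" using z by (simp add: lattice_ball_def)
  qed
qed

lemma incseq_C_seq: "incseq (C_seq d L F1)"
proof (rule incseq_SucI)
  fix n show "C_seq d L F1 n \<subseteq> C_seq d L F1 (Suc n)"
  proof (induction n)
    case 0
    have "0\<^sub>v d = 0\<^sub>v d + 0\<^sub>v d + 0\<^sub>v d + - (0\<^sub>v d :: int vec)" by (auto simp: vec_eq_iff)
    then have "(0\<^sub>v d :: int vec) \<in> {0\<^sub>v d} + F1 + F1 + uminus ` F1"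
      using zero_in_F1 by (metis imageI set_plus_intro singletonI)
    then show ?case using mat_mult_zero_vec[OF L_carrier] by simp
  next
    case (Suc n)
    then have "C_seq d L F1 n + F1 + F1 + uminus ` F1 \<subseteq> C_seq d L F1 (Suc n) + F1 + F1 + uminus ` F1"
      by (intro set_plus_mono2 order_refl)
    then show ?case
      unfolding C_seq.simps(2)[of d L F1 "Suc n"] by (subst C_seq.simps(2)) blast
  qed
qed

text \<open>The sequence increases inside a finite ball, so it stabilizes at its union; this is the
  unique value that \<open>THE\<close> selects.\<close>

lemma C_set_props: "0\<^sub>v d \<in> C_set d L F1" "C_set d L F1 \<subseteq> lattice_ball d (3 * r)"
proof -
  obtain N where N: "\<And>n. n \<ge> N \<Longrightarrow> C_seq d L F1 n = (\<Union>k. C_seq d L F1 k)"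
    using incseq_subset_finite_eventually_const[OF incseq_C_seq C_seq_subset_ball finite_lattice_ball]
    by metis
  have "C_set d L F1 = (\<Union>k. C_seq d L F1 k)" unfolding C_set_def
  proof (rule the_equality)
    show ev: "\<forall>\<^sub>F n in sequentially. C_seq d L F1 n = (\<Union>k. C_seq d L F1 k)"
      using N eventually_sequentially by blast
    fix S assume "\<forall>\<^sub>F n in sequentially. C_seq d L F1 n = S"
    then have "\<forall>\<^sub>F n in sequentially. S = (\<Union>k. C_seq d L F1 k)"
      using ev by eventually_elim simp
    then show "S = (\<Union>k. C_seq d L F1 k)" by simp
  qed
  moreover have "0\<^sub>v d \<in> C_seq d L F1 0" by simp
  ultimately show "0\<^sub>v d \<in> C_set d L F1" "C_set d L F1 \<subseteq> lattice_ball d (3 * r)"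
    using C_seq_subset_ball by blast+
qed

text \<open>A run still outside after \<open>a - b\<close> steps would have lost
  \<open>a - b\<close> from a measure of at most \<open>a\<close>, yet its measure exceeds
  \<open>b\<close>.\<close>

lemma zero_run_uniform:
  fixes \<mu> :: "int vec \<Rightarrow> nat"
  assumes \<mu>: "\<And>z z'. z \<in> carrier_vec d \<Longrightarrow> z' \<in> carrier_vec d \<Longrightarrow>
      vnorm (real_vec z') < vnorm (real_vec z) \<Longrightarrow> \<mu> z' < \<mu> z"
    and a: "\<And>z. z \<in> carrier_vec d \<Longrightarrow> vnorm (real_vec z) \<le> s \<Longrightarrow> \<mu> z \<le> a"
    and b: "\<And>z. z \<in> carrier_vec d \<Longrightarrow> 2 * r < vnorm (real_vec z) \<Longrightarrow> b < \<mu> z"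
    and z: "z \<in> lattice_ball d s"
  shows "foldl step z (replicate (a - b) (0\<^sub>v d)) \<in> lattice_ball d (2 * r)"
proof (rule ccontr)
  let ?w = "replicate (a - b) (0\<^sub>v d :: int vec)"
  assume *: "\<not> ?thesis"
  have zc: "z \<in> carrier_vec d" "\<mu> z \<le> a" using lattice_ballD[OF z] a by auto
  have w: "set ?w \<subseteq> F1" using zero_in_F1 by auto
  have "foldl step z ?w \<in> carrier_vec d" by (rule run_carrier[OF zc(1) w])
  then have "b < \<mu> (foldl step z ?w)" using * b by (auto simp: lattice_ball_def)
  moreover have "\<mu> (foldl step z ?w) + (a - b) \<le> \<mu> z"
    using run_enters_ball[OF \<mu> zc(1) w] * by simp
  ultimately show False using zc(2) by simp
qed

text \<open>In dimension 1 the norm itself is an integer and counts the steps. The squared norm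
  would give 3 instead of 1 at \<open>r = 1 / 2\<close>, where the final bound leaves no
  slack.\<close>

definition waiting_time :: nat where
  "waiting_time = (if d = 1 then nat \<lfloor>4 * r\<rfloor> - nat \<lfloor>2 * r\<rfloor> else nat \<lfloor>16 * r\<^sup>2\<rfloor> - nat \<lfloor>4 * r\<^sup>2\<rfloor>)"

lemma waiting_time_le: "real waiting_time \<le> 12 * r\<^sup>2 + 1" if "d \<ge> 2"
proof -
  have r2: "0 \<le> r\<^sup>2" by simp
  then have "nat \<lfloor>4 * r\<^sup>2\<rfloor> \<le> nat \<lfloor>16 * r\<^sup>2\<rfloor>" by (intro nat_mono floor_mono) simp
  moreover have "real (nat \<lfloor>16 * r\<^sup>2\<rfloor>) \<le> 16 * r\<^sup>2" "4 * r\<^sup>2 - 1 \<le> real (nat \<lfloor>4 * r\<^sup>2\<rfloor>)"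
    using r2 by linarith+
  ultimately have "real (nat \<lfloor>16 * r\<^sup>2\<rfloor> - nat \<lfloor>4 * r\<^sup>2\<rfloor>) \<le> 12 * r\<^sup>2 + 1" by linarith
  then show ?thesis unfolding waiting_time_def using that by simp
qed

lemma zero_run_waiting_time:
  assumes z: "z \<in> lattice_ball d (4 * r)"
  shows "foldl step z (replicate waiting_time (0\<^sub>v d)) \<in> lattice_ball d (2 * r)"
proof (cases "d = 1")
  case True
  have vnorm1: "vnorm (real_vec x) = real (nat \<bar>x $ 0\<bar>)" if "x \<in> carrier_vec d" for x
    using that True by (simp add: vnorm_def L2_set_def lessThan_Suc)
  show ?thesis
    unfolding waiting_time_def if_P[OF True]
  proof (rule zero_run_uniform[where \<mu> = "\<lambda>z. nat \<bar>z $ 0\<bar>", OF _ _ _ z])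
    fix x :: "int vec" assume x: "x \<in> carrier_vec d"
    show "nat \<bar>x $ 0\<bar> \<le> nat \<lfloor>4 * r\<rfloor>" if "vnorm (real_vec x) \<le> 4 * r"
      using that unfolding vnorm1[OF x] by linarith
    show "nat \<lfloor>2 * r\<rfloor> < nat \<bar>x $ 0\<bar>" if "2 * r < vnorm (real_vec x)"
      using that r_nonneg unfolding vnorm1[OF x] by linarith
    show "nat \<bar>y $ 0\<bar> < nat \<bar>x $ 0\<bar>"
      if "y \<in> carrier_vec d" "vnorm (real_vec y) < vnorm (real_vec x)" for y
      using that(2) unfolding vnorm1[OF x] vnorm1[OF that(1)] of_nat_less_iff .
  qed
next
  case False
  show ?thesis
    unfolding waiting_time_def if_not_P[OF False]
  proof (rule zero_run_uniform[where \<mu> = sq_norm_nat, OF _ _ _ z])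
    fix x assume "vnorm (real_vec x) \<le> 4 * r"
    then have "(vnorm (real_vec x))\<^sup>2 \<le> (4 * r)\<^sup>2" using vnorm_nonneg by (intro power_mono) auto
    then have "real (sq_norm_nat x) \<le> 16 * r\<^sup>2" by (simp add: real_sq_norm_nat power_mult_distrib)
    then show "sq_norm_nat x \<le> nat \<lfloor>16 * r\<^sup>2\<rfloor>" by linarith
  next
    fix x assume "2 * r < vnorm (real_vec x)"
    then have "(2 * r)\<^sup>2 < (vnorm (real_vec x))\<^sup>2" using r_nonneg by (intro power_strict_mono) auto
    then have "4 * r\<^sup>2 < real (sq_norm_nat x)" by (simp add: real_sq_norm_nat power_mult_distrib)
    moreover have "0 \<le> 4 * r\<^sup>2" by simp
    ultimately show "nat \<lfloor>4 * r\<^sup>2\<rfloor> < sq_norm_nat x" by linarith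
  qed (rule sq_norm_nat_less)
qed

lemma folner_iff_contains_translate:
  "folner d (F_seq d L F1) \<longleftrightarrow>
    (\<exists>n\<ge>1. real n \<le> ((6 * r) ^ (3 * d) - (6 * r) ^ d) / 6 \<and>
      contains_translate d (F_seq d L F1 n) (C_set d L F1 + lattice_ball d r))"
proof
  let ?N = "card (lattice_ball d (2 * r))" and ?S = "C_set d L F1 + lattice_ball d r"
  define bound where "bound = ((6 * r) ^ (3 * d) - (6 * r) ^ d) / 6"
  assume "folner d (F_seq d L F1)"
  then obtain u where u: "set u \<subseteq> F1" "length u \<le> ?N * (?N - 1) div 2"
      "\<And>z. z \<in> lattice_ball d (2 * r) \<Longrightarrow> foldl step z u = 0\<^sub>v d"
    using synchronizing_word_ball[OF order_refl] unfolding folner_iff_reach by blast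
  have "real (waiting_time + ?N * (?N - 1) div 2) \<le> bound"
    unfolding bound_def
  proof (rule length_bound[OF half_le_r d_pos])
    show "real ?N \<le> (4 * r + 1) ^ d" using card_lattice_ball[of "2 * r" d] r_nonneg by simp
    show "waiting_time = nat \<lfloor>4 * r\<rfloor> - nat \<lfloor>2 * r\<rfloor>" if "d = 1"
      unfolding waiting_time_def using that by (rule if_P)
  qed (rule waiting_time_le)
  moreover have "1 \<le> bound"
  proof -
    have "3 ^ 1 \<le> (6 * r) ^ 1" using half_le_r by simp
    also have "\<dots> \<le> (6 * r) ^ d" using half_le_r d_pos by (intro power_increasing) auto
    finally have m: "3 \<le> (6 * r) ^ d" by simp
    have "1 \<le> (y ^ 3 - y) / 6" if "3 \<le> y" for y :: real
    proof -
      have "y * 9 \<le> y * y\<^sup>2"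
        using that power_mono[of 3 y 2] by (intro mult_left_mono) auto
      moreover have "1 \<le> (x - y) / 6" if "y * 9 \<le> x" for x
        using that \<open>3 \<le> y\<close> by simp
      ultimately show ?thesis by (simp add: power3_eq_cube power2_eq_square mult.assoc)
    qed
    from this[OF m] have "1 \<le> (((6 * r) ^ d) ^ 3 - (6 * r) ^ d) / 6" .
    then show ?thesis
      unfolding bound_def using power_mult[of "6 * r" d 3] by (simp only: mult.commute)
  qed
  define n where "n = nat \<lfloor>bound\<rfloor>"
  have n: "1 \<le> n" "real n \<le> bound" using \<open>1 \<le> bound\<close> unfolding n_def by linarith+
  have "waiting_time + length u \<le> n"
    using u(2) \<open>real (waiting_time + ?N * (?N - 1) div 2) \<le> bound\<close> unfolding n_def by linarith
  \<comment> \<open>The leading zeros bring the ball of radius \<open>4 * r\<close> into that of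
    radius \<open>2 * r\<close>, where \<open>u\<close> synchronizes. The trailing zeros fix the
    absorbing state and adjust the length to \<open>n\<close>.\<close>
  define w where "w = replicate waiting_time (0\<^sub>v d) @ u @ replicate (n - waiting_time - length u) (0\<^sub>v d)"
  have w: "set w \<subseteq> F1" "length w = n"
    using u(1) zero_in_F1 \<open>waiting_time + length u \<le> n\<close> by (auto simp: w_def)
  have t: "digit_value d L w \<in> carrier_vec d" using w(1) by (rule digit_value_carrier)
  have "digit_value d L w + (c + b) \<in> F_seq d L F1 n"
    if c: "c \<in> C_set d L F1" and b: "b \<in> lattice_ball d r" for c b
  proof -
    have cb: "c \<in> carrier_vec d" "b \<in> carrier_vec d"
        "vnorm (real_vec c) \<le> 3 * r" "vnorm (real_vec b) \<le> r"
      using C_set_props(2) c lattice_ballD[OF b] lattice_ballD by auto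
    then have "c + b \<in> lattice_ball d (4 * r)"
      using vnorm_triangle[of "real_vec c" d "real_vec b"] real_vec_add[OF cb(1,2)]
      by (simp add: lattice_ball_def)
    then have "foldl step (c + b) (replicate waiting_time (0\<^sub>v d) @ u) = 0\<^sub>v d"
      using zero_run_waiting_time u(3) by simp
    moreover have "foldl step (0\<^sub>v d) (replicate k (0\<^sub>v d)) = 0\<^sub>v d" for k
      by (induction k) (simp_all add: step_zero zero_in_F1)
    ultimately have "foldl step (c + b) w = 0\<^sub>v d" by (simp add: w_def)
    then have "(c + b) + digit_value d L w \<in> F_seq d L F1 n"
      using add_mem_F_seq_iff[of "c + b" w] w cb by simp
    then show ?thesis using comm_add_vec[OF t, of "c + b"] cb by simp
  qed
  then have "{digit_value d L w} + ?S \<subseteq> F_seq d L F1 n" by (auto simp: set_plus_def)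
  then have "contains_translate d (F_seq d L F1 n) ?S" unfolding contains_translate_def using t by blast
  then show "\<exists>n\<ge>1. real n \<le> ((6 * r) ^ (3 * d) - (6 * r) ^ d) / 6 \<and>
      contains_translate d (F_seq d L F1 n) ?S"
    using n unfolding bound_def by blast
next
  let ?S = "C_set d L F1 + lattice_ball d r"
  assume "\<exists>n\<ge>1. real n \<le> ((6 * r) ^ (3 * d) - (6 * r) ^ d) / 6 \<and>
      contains_translate d (F_seq d L F1 n) ?S"
  then obtain n t where t: "t \<in> carrier_vec d" "{t} + ?S \<subseteq> F_seq d L F1 n"
    unfolding contains_translate_def by blast
  \<comment> \<open>Since \<open>C\<close> contains 0, the translate contains
    \<open>t + B(0, r)\<close>. In particular \<open>t\<close> lies in \<open>F_n\<close>, and its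
    digits form a word that sends all of \<open>B(0, r)\<close> to 0.\<close>
  have mem: "t + b \<in> F_seq d L F1 n" if "b \<in> lattice_ball d r" for b
  proof -
    have "0\<^sub>v d + b \<in> ?S" using C_set_props(1) that by (rule set_plus_intro)
    then have "t + (0\<^sub>v d + b) \<in> {t} + ?S" by (rule set_plus_intro[OF singletonI])
    then show ?thesis using t(2) lattice_ballD[OF that] by auto
  qed
  have "t \<in> F_seq d L F1 n" using mem[OF zero_in_ball[OF r_nonneg]] t(1) by simp
  then obtain w where w: "w \<in> words n" "t = digit_value d L w" unfolding F_seq_eq by blast
  have sync: "foldl step b w = 0\<^sub>v d" if b: "b \<in> lattice_ball d r" for b
  proof -
    have bc: "b \<in> carrier_vec d" using lattice_ballD[OF b] ..
    have "b + digit_value d L w \<in> F_seq d L F1 (length w)"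
      using mem[OF b] w comm_add_vec[OF t(1) bc] by simp
    then show ?thesis using add_mem_F_seq_iff[OF bc, of w] w(1) by simp
  qed
  show "folner d (F_seq d L F1)"
    unfolding folner_iff_reach
  proof
    fix z :: "int vec" assume "z \<in> carrier_vec d"
    then obtain k where "foldl step z (replicate k (0\<^sub>v d)) \<in> lattice_ball d r"
      using zero_run_enters_ball by blast
    then have "foldl step z (replicate k (0\<^sub>v d) @ w) = 0\<^sub>v d" using sync by simp
    then show "\<exists>w. set w \<subseteq> F1 \<and> foldl step z w = 0\<^sub>v d"
      using w(1) zero_in_F1 by (intro exI[of _ "replicate k (0\<^sub>v d) @ w"]) auto
  qed
qed

end

section \<open>An explicit bound on the radius\<close>

lemma abs_det_le:
  fixes A :: "'a :: linordered_idom mat"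
  assumes A: "A \<in> carrier_mat n n" and le: "\<And>i j. i < n \<Longrightarrow> j < n \<Longrightarrow> \<bar>A $$ (i, j)\<bar> \<le> m"
  shows "\<bar>det A\<bar> \<le> fact n * m ^ n"
proof -
  let ?P = "{p. p permutes {0..<n}}"
  have "\<bar>det A\<bar> \<le> (\<Sum>p\<in>?P. \<bar>signof p * (\<Prod>i = 0..<n. A $$ (i, p i))\<bar>)"
    unfolding det_def'[OF A] by (rule sum_abs)
  also have "\<dots> \<le> (\<Sum>p\<in>?P. m ^ n)"
  proof (rule sum_mono)
    fix p assume p: "p \<in> ?P"
    have "\<bar>signof p * (\<Prod>i = 0..<n. A $$ (i, p i))\<bar> = (\<Prod>i = 0..<n. \<bar>A $$ (i, p i)\<bar>)"
      by (simp add: abs_mult abs_prod sign_def)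
    also have "\<dots> \<le> (\<Prod>i = 0..<n. m)"
      using p le permutes_in_image[of p "{0..<n}"] by (intro prod_mono) auto
    finally show "\<bar>signof p * (\<Prod>i = 0..<n. A $$ (i, p i))\<bar> \<le> m ^ n" by simp
  qed
  also have "\<dots> = fact n * m ^ n"
    using card_permutations[of "{0..<n}" n] by simp
  finally show ?thesis .
qed

lemma abs_adj_mat_le:
  fixes A :: "'a :: linordered_idom mat"
  assumes A: "A \<in> carrier_mat n n" and le: "\<And>i j. i < n \<Longrightarrow> j < n \<Longrightarrow> \<bar>A $$ (i, j)\<bar> \<le> m"
    and ij: "i < n" "j < n"
  shows "\<bar>adj_mat A $$ (i, j)\<bar> \<le> fact (n - 1) * m ^ (n - 1)"
proof -
  have "\<bar>adj_mat A $$ (i, j)\<bar> = \<bar>det (mat_delete A j i)\<bar>"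
    using A ij by (simp add: adj_mat_def cofactor_def abs_mult power_abs)
  also have "\<dots> \<le> fact (n - 1) * m ^ (n - 1)"
  proof (rule abs_det_le[OF mat_delete_carrier[OF A]])
    fix i' j' assume "i' < n - 1" "j' < n - 1"
    then show "\<bar>mat_delete A j i $$ (i', j')\<bar> \<le> m"
      using A ij le by (auto simp: mat_delete_def)
  qed
  finally show ?thesis .
qed

lemma vnorm_sq_scalar_prod: "(vnorm v)\<^sup>2 = v \<bullet> v"
  unfolding vnorm_sq by (simp add: scalar_prod_def power2_eq_square lessThan_atLeast0)

text \<open>There are at most \<open>c ^ 2\<close> entries of the adjugate, each at most
  \<open>c! * (c ^ 3 + 1) ^ c\<close>, where \<open>c ^ 3 + 1\<close> bounds the entries of
  \<open>L^T L - 1\<close>. The power \<open>c ^ c\<close> replaces the factorial, so that the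
  available computability rules apply.\<close>

definition inverse_bound :: "nat \<Rightarrow> nat" where
  "inverse_bound c = c ^ 2 * (c ^ c * (c ^ 3 + 1) ^ c)"

text \<open>Comes from \<open>1 - q >= 1 / (2 * (K + 1))\<close>, with \<open>K\<close> the inverse
  bound, and from \<open>c ^ 2\<close> as a bound for the numerator of \<open>rbar\<close>; one more
  factor 2 accounts for \<open>2 * r\<close>.\<close>

definition radius_bound :: "nat \<Rightarrow> nat" where
  "radius_bound c = 4 * (inverse_bound c + 1) * c ^ 2"

section \<open>Quantitative expansion from integrality\<close>

context digit_system
begin

context
  fixes c :: nat
  assumes d_le: "d \<le> c" and L_le: "\<And>i j. i < d \<Longrightarrow> j < d \<Longrightarrow> \<bar>L $$ (i, j)\<bar> \<le> int c"
    and F1_le: "\<And>f i. f \<in> F1 \<Longrightarrow> i < d \<Longrightarrow> \<bar>f $ i\<bar> \<le> int c"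
begin

text \<open>Its quadratic form is the squared norm of \<open>L v\<close> minus that of
  \<open>v\<close>: expansion makes it positive definite, and integrality of the entries keeps its
  determinant away from 0.\<close>

definition A :: "real mat" where "A = LR\<^sup>T * LR - 1\<^sub>m d"

lemma A_carrier: "A \<in> carrier_mat d d"
  by (simp add: A_def minus_carrier_mat)

lemma scalar_prod_A:
  assumes u: "u \<in> carrier_vec d" and v: "v \<in> carrier_vec d"
  shows "u \<bullet> (A *\<^sub>v v) = (LR *\<^sub>v u) \<bullet> (LR *\<^sub>v v) - u \<bullet> v"
proof -
  have T: "LR\<^sup>T \<in> carrier_mat d d" by simp
  have w: "LR\<^sup>T *\<^sub>v (LR *\<^sub>v v) \<in> carrier_vec d" by (rule carrier_vecI) (simp add: LR_def carrier_matD[OF L_carrier])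
  have "A *\<^sub>v v = LR\<^sup>T *\<^sub>v (LR *\<^sub>v v) - v"
    unfolding A_def
    by (subst minus_mult_distrib_mat_vec[of _ d d]) (use v mult_carrier_mat[OF T LR_carrier] in \<open>auto simp: assoc_mult_mat_vec[OF T LR_carrier]\<close>)
  then have "u \<bullet> (A *\<^sub>v v) = u \<bullet> (LR\<^sup>T *\<^sub>v (LR *\<^sub>v v)) - u \<bullet> v"
    using scalar_prod_minus_distrib[OF u w v] by simp
  also have "u \<bullet> (LR\<^sup>T *\<^sub>v (LR *\<^sub>v v)) = (LR\<^sup>T *\<^sub>v (LR *\<^sub>v v)) \<bullet> u"
    by (rule comm_scalar_prod[OF u w])
  also have "\<dots> = (LR *\<^sub>v v) \<bullet> (LR *\<^sub>v u)"
    by (rule transpose_vec_mult_scalar[OF LR_carrier u LR_mult_carrier])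
  also have "\<dots> = (LR *\<^sub>v u) \<bullet> (LR *\<^sub>v v)"
    by (rule comm_scalar_prod) auto
  finally show ?thesis .
qed

lemma A_pos:
  assumes "v \<in> carrier_vec d" "v \<noteq> 0\<^sub>v d"
  shows "0 < v \<bullet> (A *\<^sub>v v)"
proof -
  obtain b where b: "b > 1" "b * vnorm v < vnorm (LR *\<^sub>v v)"
    using expansion assms unfolding expansion_mat_def LR_def by blast
  have "1 * vnorm v \<le> b * vnorm v" using b(1) vnorm_nonneg by (intro mult_right_mono) auto
  then have "vnorm v < vnorm (LR *\<^sub>v v)" using b(2) by simp
  then have "(vnorm v)\<^sup>2 < (vnorm (LR *\<^sub>v v))\<^sup>2" using vnorm_nonneg by (intro power_strict_mono) auto
  then show ?thesis unfolding scalar_prod_A[OF assms(1,1)] vnorm_sq_scalar_prod by simp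
qed

lemma A_nonneg:
  assumes v: "v \<in> carrier_vec d"
  shows "0 \<le> v \<bullet> (A *\<^sub>v v)"
proof (cases "v = 0\<^sub>v d")
  case True
  then have "A *\<^sub>v v = 0\<^sub>v d" using mat_mult_zero_vec[OF A_carrier] by simp
  then show ?thesis using scalar_prod_right_zero[OF v] by simp
qed (use A_pos[OF v] in simp)

lemma A_eq: "A = map_mat real_of_int (L\<^sup>T * L - 1\<^sub>m d)"
  unfolding A_def LR_def using carrier_matD[OF L_carrier]
  by (intro eq_matI) (auto simp: scalar_prod_def)

lemma abs_det_A: "1 \<le> \<bar>det A\<bar>"
proof -
  have "det A \<noteq> 0"
  proof
    assume "det A = 0"
    then obtain v where v: "v \<in> carrier_vec d" "v \<noteq> 0\<^sub>v d" "A *\<^sub>v v = 0\<^sub>v d"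
      using det_0_iff_vec_prod_zero_field[OF A_carrier] by blast
    then show False using A_pos[OF v(1,2)] by simp
  qed
  moreover have "det A = real_of_int (det (L\<^sup>T * L - 1\<^sub>m d))"
    unfolding A_eq by (rule of_int_hom.hom_det)
  ultimately show ?thesis by simp
qed

lemma abs_A_le:
  assumes "i < d" "j < d"
  shows "\<bar>A $$ (i, j)\<bar> \<le> real c ^ 3 + 1"
proof -
  have "\<bar>\<Sum>k<d. L $$ (k, i) * L $$ (k, j)\<bar> \<le> (\<Sum>k<d. \<bar>L $$ (k, i)\<bar> * \<bar>L $$ (k, j)\<bar>)"
    by (rule order_trans[OF sum_abs]) (simp add: abs_mult)
  also have "\<dots> \<le> (\<Sum>k<d. int c * int c)"
    using assms L_le by (intro sum_mono mult_mono) auto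
  also have "\<dots> \<le> int c * (int c * int c)"
    using d_le by (simp add: mult_right_mono)
  finally have *: "\<bar>\<Sum>k<d. L $$ (k, i) * L $$ (k, j)\<bar> \<le> int c * (int c * int c)" .
  have "A $$ (i, j) = real_of_int ((\<Sum>k<d. L $$ (k, i) * L $$ (k, j)) - (if i = j then 1 else 0))"
    unfolding A_eq using assms carrier_matD[OF L_carrier]
    by (simp add: scalar_prod_def lessThan_atLeast0)
  then have "\<bar>A $$ (i, j)\<bar> \<le> real_of_int (\<bar>\<Sum>k<d. L $$ (k, i) * L $$ (k, j)\<bar> + 1)"
    by auto
  also have "\<dots> \<le> real_of_int (int c * (int c * int c) + 1)"
    using * by (simp only: of_int_le_iff)
  finally show ?thesis by (simp add: power3_eq_cube mult.assoc)
qed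

lemma c_pos: "1 \<le> c"
  using d_pos d_le by simp

lemma inverse_bound_pos: "0 < inverse_bound c"
  using c_pos by (simp add: inverse_bound_def)

lemma sum_adj_A_le: "(\<Sum>i<d. \<Sum>j<d. \<bar>adj_mat A $$ (i, j)\<bar>) \<le> real (inverse_bound c)"
proof -
  have "fact (d - 1) * (real c ^ 3 + 1) ^ (d - 1) \<le> real c ^ c * (real c ^ 3 + 1) ^ c"
  proof (rule mult_mono)
    have "(fact (d - 1) :: nat) \<le> fact c" using d_le by (intro fact_mono_nat) simp
    also have "\<dots> \<le> c ^ c" using fact_le_power[where 'a = nat and n = c] by simp
    finally show "fact (d - 1) \<le> real c ^ c"
      by (metis of_nat_fact of_nat_le_iff of_nat_power)
    show "(real c ^ 3 + 1) ^ (d - 1) \<le> (real c ^ 3 + 1) ^ c"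
      using d_le by (intro power_increasing) auto
  qed auto
  then have "\<bar>adj_mat A $$ (i, j)\<bar> \<le> real c ^ c * (real c ^ 3 + 1) ^ c" if "i < d" "j < d" for i j
    using abs_adj_mat_le[OF A_carrier abs_A_le that] by (rule order_trans[rotated])
  then have "(\<Sum>i<d. \<Sum>j<d. \<bar>adj_mat A $$ (i, j)\<bar>) \<le>
      (\<Sum>i<d. \<Sum>j<d. real c ^ c * (real c ^ 3 + 1) ^ c)"
    by (intro sum_mono) auto
  also have "\<dots> = real d ^ 2 * (real c ^ c * (real c ^ 3 + 1) ^ c)"
    by (simp add: power2_eq_square)
  also have "\<dots> \<le> real c ^ 2 * (real c ^ c * (real c ^ 3 + 1) ^ c)"
    using d_le by (intro mult_right_mono power_mono) auto
  finally show ?thesis by (simp add: inverse_bound_def add.commute)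
qed

text \<open>Here \<open>K\<close> bounds the sum of the absolute entries of the adjugate of \<open>A = L\<^sup>T L - 1\<close>, and hence
  those of \<open>A\<^sup>-\<^sup>1\<close>, as \<open>\<bar>det A\<bar> \<ge> 1\<close>. Evaluate the positive form of \<open>A\<close> at \<open>x - y\<close> where \<open>A y = x / K\<close>.\<close>

lemma quantitative_expansion:
  assumes x: "x \<in> carrier_vec d"
  shows "(1 + 1 / real (inverse_bound c)) * (vnorm x)\<^sup>2 \<le> (vnorm (LR *\<^sub>v x))\<^sup>2"
proof -
  define K where "K = real (inverse_bound c)"
  have K: "K > 0" using inverse_bound_pos by (simp add: K_def)
  define G where "G = adj_mat A"
  have G: "G \<in> carrier_mat d d" "A * G = det A \<cdot>\<^sub>m 1\<^sub>m d" unfolding G_def using adj_mat[OF A_carrier] by auto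
  \<comment> \<open>The adjugate inverts \<open>A\<close> up to the factor \<open>det A\<close>; the
    scalar is chosen to give \<open>A y = x / K\<close>.\<close>
  define a where "a = 1 / (det A * K)"
  define y where "y = a \<cdot>\<^sub>v (G *\<^sub>v x)"
  have Gx: "G *\<^sub>v x \<in> carrier_vec d" by (rule carrier_vecI) (simp add: carrier_matD[OF G(1)])
  then have y: "y \<in> carrier_vec d" by (simp add: y_def)
  have "A *\<^sub>v y = a \<cdot>\<^sub>v (A *\<^sub>v (G *\<^sub>v x))" unfolding y_def by (rule mult_mat_vec[OF A_carrier Gx])
  also have "A *\<^sub>v (G *\<^sub>v x) = (A * G) *\<^sub>v x" by (rule assoc_mult_mat_vec[OF A_carrier G(1) x, symmetric])
  also have "\<dots> = det A \<cdot>\<^sub>v x" unfolding G(2) using x by (intro eq_vecI) auto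
  finally have Ay: "A *\<^sub>v y = (1 / K) \<cdot>\<^sub>v x" using abs_det_A by (simp add: smult_smult_assoc a_def)
  have "\<bar>y \<bullet> x\<bar> \<le> (vnorm x)\<^sup>2"
  proof -
    have "(G *\<^sub>v x) \<bullet> x = (\<Sum>i<d. \<Sum>j<d. G $$ (i, j) * (x $ j * x $ i))"
      using x carrier_matD[OF G(1)]
      by (simp add: scalar_prod_def lessThan_atLeast0 sum_distrib_right mult.assoc)
    also have "\<bar>\<dots>\<bar> \<le> (\<Sum>i<d. \<Sum>j<d. \<bar>G $$ (i, j) * (x $ j * x $ i)\<bar>)"
      by (rule order_trans[OF sum_abs]) (intro sum_mono sum_abs)
    also have "\<dots> \<le> (\<Sum>i<d. \<Sum>j<d. \<bar>G $$ (i, j)\<bar> * (vnorm x)\<^sup>2)"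
      using x abs_component_le_vnorm[of _ x] vnorm_nonneg[of x]
      by (intro sum_mono) (auto simp: abs_mult power2_eq_square intro!: mult_left_mono mult_mono)
    also have "\<dots> = (\<Sum>i<d. \<Sum>j<d. \<bar>G $$ (i, j)\<bar>) * (vnorm x)\<^sup>2"
      by (simp add: sum_distrib_right)
    also have "\<dots> \<le> K * (vnorm x)\<^sup>2"
      unfolding G_def K_def by (intro mult_right_mono sum_adj_A_le) simp
    finally have *: "\<bar>(G *\<^sub>v x) \<bullet> x\<bar> \<le> K * (vnorm x)\<^sup>2" .
    have "K * 1 \<le> K * \<bar>det A\<bar>" using K abs_det_A by (intro mult_left_mono) auto
    have "\<bar>y \<bullet> x\<bar> = \<bar>(G *\<^sub>v x) \<bullet> x\<bar> / (\<bar>det A\<bar> * K)"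
      unfolding y_def smult_scalar_prod_distrib[OF Gx x] a_def using K by (simp add: abs_mult)
    also have "\<dots> \<le> K * (vnorm x)\<^sup>2 / (\<bar>det A\<bar> * K)"
      using * K by (intro divide_right_mono) auto
    also have "\<dots> = (vnorm x)\<^sup>2 / \<bar>det A\<bar>" using K by simp
    also have "\<dots> \<le> (vnorm x)\<^sup>2 / 1" using abs_det_A by (intro divide_left_mono) auto
    finally show ?thesis by simp
  qed
  then have yy: "y \<bullet> (A *\<^sub>v y) \<le> (vnorm x)\<^sup>2 / K"
    unfolding Ay using x y K by (simp add: divide_right_mono)
  have xy: "x \<bullet> (A *\<^sub>v y) = (vnorm x)\<^sup>2 / K"
    unfolding Ay vnorm_sq_scalar_prod using x K by simp
  have Ac: "A *\<^sub>v v \<in> carrier_vec d" for v by (rule carrier_vecI) (simp add: carrier_matD[OF A_carrier])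
  have yx: "y \<bullet> (A *\<^sub>v x) = x \<bullet> (A *\<^sub>v y)"
    unfolding scalar_prod_A[OF x y] scalar_prod_A[OF y x]
    using comm_scalar_prod[OF x y] comm_scalar_prod[OF LR_mult_carrier LR_mult_carrier, of x y] by simp
  \<comment> \<open>In the expansion both mixed terms equal \<open>(vnorm x)^2 / K\<close> and the
    term in \<open>y\<close> alone is at most that, so the term in \<open>x\<close> is at least
    \<open>(vnorm x)^2 / K\<close>.\<close>
  have "0 \<le> (x - y) \<bullet> (A *\<^sub>v (x - y))"
    using A_nonneg x y by simp
  also have "A *\<^sub>v (x - y) = A *\<^sub>v x - A *\<^sub>v y" by (rule mult_minus_distrib_mat_vec[OF A_carrier x y])
  also have "(x - y) \<bullet> \<dots> = x \<bullet> (A *\<^sub>v x) - x \<bullet> (A *\<^sub>v y) - (y \<bullet> (A *\<^sub>v x) - y \<bullet> (A *\<^sub>v y))"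
    using minus_scalar_prod_distrib[OF x y, of "A *\<^sub>v x - A *\<^sub>v y"]
      scalar_prod_minus_distrib[OF x Ac Ac] scalar_prod_minus_distrib[OF y Ac Ac] Ac by simp
  also have "\<dots> \<le> x \<bullet> (A *\<^sub>v x) - (vnorm x)\<^sup>2 / K"
    using yy yx xy by simp
  finally have "(vnorm x)\<^sup>2 / K \<le> (vnorm (LR *\<^sub>v x))\<^sup>2 - (vnorm x)\<^sup>2"
    unfolding scalar_prod_A[OF x x] vnorm_sq_scalar_prod by simp
  then show ?thesis unfolding K_def[symmetric] by (simp add: algebra_simps)
qed

text \<open>Quantitative expansion bounds the square of the contraction factor by
  \<open>1 - 1 / (K + 1)\<close>. A square root is avoided, since
  \<open>(1 - e)^2 >= 1 - 2 * e\<close>.\<close>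

lemma q_le_bound: "q \<le> 1 - 1 / (2 * (real (inverse_bound c) + 1))"
proof (rule q_le)
  define K where "K = real (inverse_bound c)"
  have K: "K > 0" using inverse_bound_pos by (simp add: K_def)
  define b where "b = 1 - 1 / (2 * (K + 1))"
  have b0: "0 \<le> b" using K by (simp add: b_def field_simps)
  show "0 \<le> 1 - 1 / (2 * (real (inverse_bound c) + 1))" using b0 unfolding b_def K_def .
  fix v :: "real vec" assume v: "v \<in> carrier_vec d"
  have "(1 + 1 / K) * (vnorm (M *\<^sub>v v))\<^sup>2 \<le> (vnorm v)\<^sup>2"
    using quantitative_expansion[OF M_mult_carrier, of v] LR_M[OF v] by (simp add: K_def)
  moreover have "1 + 1 / K = (K + 1) / K" using K by (simp add: field_simps)
  ultimately have "(vnorm (M *\<^sub>v v))\<^sup>2 \<le> (1 - 1 / (K + 1)) * (vnorm v)\<^sup>2"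
    using K by (simp add: field_simps)
  also have "\<dots> \<le> b\<^sup>2 * (vnorm v)\<^sup>2"
  proof (rule mult_right_mono)
    define e where "e = 1 / (2 * (K + 1))"
    have "1 / (K + 1) = 2 * e" "b = 1 - e" using K by (simp_all add: b_def e_def field_simps)
    then have "b\<^sup>2 = 1 - 1 / (K + 1) + e\<^sup>2" by (simp only: power2_diff) simp
    then show "1 - 1 / (K + 1) \<le> b\<^sup>2" by simp
  qed simp
  finally have "(vnorm (M *\<^sub>v v))\<^sup>2 \<le> (b * vnorm v)\<^sup>2"
    by (simp only: power_mult_distrib)
  then have "vnorm (M *\<^sub>v v) \<le> b * vnorm v"
    by (rule power2_le_imp_le) (simp add: b0 vnorm_nonneg)
  then show "vnorm (M *\<^sub>v v) \<le> (1 - 1 / (2 * (real (inverse_bound c) + 1))) * vnorm v"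
    unfolding b_def K_def .
qed

lemma r_le_radius_bound: "2 * r \<le> real (radius_bound c)"
proof -
  define K where "K = real (inverse_bound c)"
  have K: "K > 0" using inverse_bound_pos by (simp add: K_def)
  have "vnorm (M *\<^sub>v real_vec f) \<le> real c ^ 2" if f: "f \<in> F1" for f
  proof -
    have fc: "f \<in> carrier_vec d" using f by (rule F1_carrier)
    have "vnorm (M *\<^sub>v real_vec f) \<le> 1 * vnorm (real_vec f)"
      using vnorm_M[of "real_vec f"] fc q_less_1 vnorm_nonneg[of "real_vec f"]
      by (meson less_imp_le map_carrier_vec mult_right_mono order_trans)
    also have "\<dots> \<le> (\<Sum>i<d. \<bar>real_of_int (f $ i)\<bar>)"
      using L2_set_le_sum_abs[of "\<lambda>i. real_of_int (f $ i)" "{..<d}"] fc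
      by (auto simp: vnorm_def L2_set_def)
    also have "\<dots> \<le> (\<Sum>i<d. real c)"
    proof (rule sum_mono)
      fix i assume "i \<in> {..<d}"
      then have "\<bar>f $ i\<bar> \<le> int c" using F1_le[OF f] by simp
      then show "\<bar>real_of_int (f $ i)\<bar> \<le> real c"
        by (metis of_int_abs of_int_le_iff of_int_of_nat_eq)
    qed
    also have "\<dots> \<le> real c ^ 2" using d_le by (simp add: power2_eq_square mult_right_mono)
    finally show ?thesis .
  qed
  then have "(1 - q) * r \<le> real c ^ 2"
    unfolding rho_eq[symmetric] set_norm_def using finite_F1 zero_in_F1 by (subst Max_le_iff) auto
  moreover have "1 / (2 * (K + 1)) * r \<le> (1 - q) * r"
    using q_le_bound r_nonneg unfolding K_def by (intro mult_right_mono) auto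
  ultimately have "1 / (2 * (K + 1)) * r \<le> real c ^ 2" by simp
  then have "2 * r \<le> 4 * (K + 1) * real c ^ 2" using K by (simp add: field_simps)
  also have "\<dots> = real (radius_bound c)" 
    by (simp only: radius_bound_def K_def of_nat_mult of_nat_add of_nat_power of_nat_numeral of_nat_1)
  finally show ?thesis .
qed

end

text \<open>The states in the ball of radius \<open>2r\<close> that do not reach \<open>0\<close> are a trap if the sequence is not
  Foelner: reading zeros leads from any state that does not reach \<open>0\<close> into this ball.\<close>

lemma not_folner_iff_trap:
  assumes R: "2 * r \<le> real R"
  shows "\<not> folner d (F_seq d L F1) \<longleftrightarrow>
    (\<exists>P \<subseteq> {z. dim_vec z = d \<and> (\<forall>i<d. \<bar>z $ i\<bar> \<le> int R)}. P \<noteq> {} \<and> 0\<^sub>v d \<notin> P \<and>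
      (\<forall>z\<in>P. \<forall>f\<in>F1. \<exists>z'\<in>P. \<exists>f'\<in>F1. z + f = L *\<^sub>v z' + f'))"
proof
  define reach where "reach = (\<lambda>z. \<exists>w. set w \<subseteq> F1 \<and> foldl step z w = 0\<^sub>v d)"
  assume "\<not> folner d (F_seq d L F1)"
  then obtain m where m: "m \<in> carrier_vec d" "\<not> reach m"
    unfolding folner_iff_reach reach_def by blast
  obtain k where k: "foldl step m (replicate k (0\<^sub>v d)) \<in> lattice_ball d r"
    using zero_run_enters_ball[OF m(1)] ..
  define P where "P = {z \<in> lattice_ball d (2 * r). \<not> reach z}"
  have reach_app: "reach z" if "reach (foldl step z v)" "set v \<subseteq> F1" for z v
    using that unfolding reach_def by (metis foldl_append le_sup_iff set_append)
  have "set (replicate k (0\<^sub>v d)) \<subseteq> F1" using zero_in_F1 by auto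
  then have p1: "foldl step m (replicate k (0\<^sub>v d)) \<in> P"
    using k m(2) reach_app[of m "replicate k (0\<^sub>v d)"] r_nonneg
    by (auto simp: P_def lattice_ball_def)
  have p2: "0\<^sub>v d \<notin> P" unfolding P_def reach_def by (auto intro: exI[of _ "[]"])
  have p3: "\<forall>z\<in>P. \<forall>f\<in>F1. \<exists>z'\<in>P. \<exists>f'\<in>F1. z + f = L *\<^sub>v z' + f'"
  proof (intro ballI)
    fix z f assume z: "z \<in> P" and f: "f \<in> F1"
    have zb: "z \<in> lattice_ball d (2 * r)" "z \<in> carrier_vec d" using z lattice_ballD by (auto simp: P_def)
    have "step z f \<in> lattice_ball d (2 * r)" using step_in_ball[OF order_refl zb(1) f] .
    moreover have "\<not> reach (step z f)" using reach_app[of z "[f]"] z f by (auto simp: P_def)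
    ultimately have "step z f \<in> P" by (simp add: P_def)
    moreover obtain f' where "f' \<in> F1" "z + f = L *\<^sub>v step z f + f'"
      using step_spec[OF zb(2) f] .
    ultimately show "\<exists>z'\<in>P. \<exists>f'\<in>F1. z + f = L *\<^sub>v z' + f'" by (intro bexI)
  qed
  have p4: "P \<subseteq> {z. dim_vec z = d \<and> (\<forall>i<d. \<bar>z $ i\<bar> \<le> int R)}"
  proof -
    have "nat \<lfloor>2 * r\<rfloor> \<le> R" using R by linarith
    then have le: "int (nat \<lfloor>2 * r\<rfloor>) \<le> int R" by (simp only: of_nat_le_iff)
    show ?thesis
    proof
      fix z assume "z \<in> P"
      then have "z \<in> lattice_ball d (2 * r)" by (simp add: P_def)
      then have "dim_vec z = d" "\<forall>i<d. \<bar>z $ i\<bar> \<le> int (nat \<lfloor>2 * r\<rfloor>)"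
        using lattice_ball_subset_box[of d "2 * r"] by auto
      then show "z \<in> {z. dim_vec z = d \<and> (\<forall>i<d. \<bar>z $ i\<bar> \<le> int R)}"
        using le order_trans by blast
    qed
  qed
  show "\<exists>P \<subseteq> {z. dim_vec z = d \<and> (\<forall>i<d. \<bar>z $ i\<bar> \<le> int R)}. P \<noteq> {} \<and> 0\<^sub>v d \<notin> P \<and>
      (\<forall>z\<in>P. \<forall>f\<in>F1. \<exists>z'\<in>P. \<exists>f'\<in>F1. z + f = L *\<^sub>v z' + f')"
    by (intro exI[of _ P] conjI p2 p3 p4) (use p1 in blast)
next
  assume "\<exists>P \<subseteq> {z. dim_vec z = d \<and> (\<forall>i<d. \<bar>z $ i\<bar> \<le> int R)}. P \<noteq> {} \<and> 0\<^sub>v d \<notin> P \<and>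
      (\<forall>z\<in>P. \<forall>f\<in>F1. \<exists>z'\<in>P. \<exists>f'\<in>F1. z + f = L *\<^sub>v z' + f')"
  then obtain P where P': "P \<subseteq> {z. dim_vec z = d \<and> (\<forall>i<d. \<bar>z $ i\<bar> \<le> int R)}" "P \<noteq> {}" "0\<^sub>v d \<notin> P"
    and clos: "\<forall>z\<in>P. \<forall>f\<in>F1. \<exists>z'\<in>P. \<exists>f'\<in>F1. z + f = L *\<^sub>v z' + f'"
    by (elim exE conjE)
  obtain m where m: "m \<in> P" using P'(2) by blast
  have "P \<subseteq> carrier_vec d"
    using P'(1) by (intro order_trans[OF P'(1)] subsetI carrier_vecI) simp
  note P = this m P'(3)
  \<comment> \<open>By uniqueness of digits, the \<open>z'\<close> of the closure condition is
    \<open>step z f\<close>. A trap can thus be tested by finite search without evaluating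
    \<open>step\<close>.\<close>
  have "step z f \<in> P" if z: "z \<in> P" "f \<in> F1" for z f
  proof -
    obtain z' f' where z': "z' \<in> P" "f' \<in> F1" "z + f = L *\<^sub>v z' + f'"
      using bspec[OF bspec[OF clos z(1)] z(2)] by (elim bexE)
    have "step z f = z'" by (rule step_unique[OF _ z(2) _ z'(2,3)]) (use P(1) z(1) z'(1) in auto)
    then show ?thesis using z'(1) by simp
  qed
  then have stay: "foldl step m w \<in> P" if "set w \<subseteq> F1" for w
    using foldl_in_closed[of P F1 step m w] that P(2) by blast
  have never: "\<not> (\<exists>w. set w \<subseteq> F1 \<and> foldl step m w = 0\<^sub>v d)"
  proof
    assume "\<exists>w. set w \<subseteq> F1 \<and> foldl step m w = 0\<^sub>v d"
    then obtain w where "set w \<subseteq> F1" "foldl step m w = 0\<^sub>v d" by blast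
    then show False using stay[of w] P(3) by simp
  qed
  show "\<not> folner d (F_seq d L F1)"
  proof
    assume "folner d (F_seq d L F1)"
    from bspec[OF this[unfolded folner_iff_reach] subsetD[OF P(1,2)]] never show False by contradiction
  qed
qed

end

section \<open>The decision procedure\<close>

lemma ex_digits:
  fixes g :: "nat \<Rightarrow> nat"
  assumes "\<And>i. i < d \<Longrightarrow> g i < b"
  shows "\<exists>s<b ^ d. \<forall>i<d. (s div b ^ i) mod b = g i"
  using assms
proof (induction d arbitrary: g)
  case (Suc d)
  obtain s where s: "s < b ^ d" "\<forall>i<d. (s div b ^ i) mod b = g (Suc i)"
    using Suc.IH[of "\<lambda>i. g (Suc i)"] Suc.prems by auto
  have g0: "g 0 < b" using Suc.prems by simp
  have "g 0 + b * s < b * Suc s" using g0 by simp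
  also have "\<dots> \<le> b * b ^ d" using s(1) by (intro mult_left_mono) auto
  finally have "g 0 + b * s < b ^ Suc d" by simp
  moreover have "((g 0 + b * s) div b ^ i) mod b = g i" if "i < Suc d" for i
  proof (cases i)
    case (Suc j)
    have "(g 0 + b * s) div b ^ i = ((g 0 + b * s) div b) div b ^ j"
      by (simp add: Suc div_mult2_eq)
    also have "(g 0 + b * s) div b = s" using g0 by simp
    finally show ?thesis using s(2) that Suc by simp
  qed (use g0 in simp)
  ultimately show ?case by blast
qed simp

lemma set_encode_less:
  assumes "S \<subseteq> {..<n}"
  shows "set_encode S < 2 ^ n"
proof -
  have "set_encode S \<le> (\<Sum>i<n. 2 ^ i)"
    unfolding set_encode_def using assms by (intro sum_mono2) auto
  also have "\<dots> < 2 ^ n" by (induction n) auto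
  finally show ?thesis .
qed

section \<open>Reading the input and searching for traps\<close>

definition input_dim :: "nat \<Rightarrow> nat" where
  "input_dim c = list_code_length (pfst c)"

definition input_entry :: "nat \<Rightarrow> nat \<Rightarrow> nat \<Rightarrow> int" where
  "input_entry c i j = int_decode (list_code_nth (list_code_nth (pfst c) i) j)"

definition input_size :: "nat \<Rightarrow> nat" where
  "input_size c = list_code_length (psnd c)"

definition input_digit :: "nat \<Rightarrow> nat \<Rightarrow> nat \<Rightarrow> int" where
  "input_digit c k i = int_decode (list_code_nth (list_code_nth (psnd c) k) i)"

text \<open>A natural number \<open>s\<close> represents the vector in the box of radius \<open>R\<close> whose coordinates, shifted
  by \<open>R\<close>, are its digits in base \<open>2R + 1\<close>. A set of vectors is represented by a bit mask.\<close>

definition box_coord :: "nat \<Rightarrow> nat \<Rightarrow> nat \<Rightarrow> int" where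
  "box_coord R s i = int ((s div (2 * R + 1) ^ i) mod (2 * R + 1)) - int R"

definition box_size :: "nat \<Rightarrow> nat" where
  "box_size c = (2 * radius_bound c + 1) ^ input_dim c"

definition coded_transition :: "nat \<Rightarrow> nat \<Rightarrow> nat \<Rightarrow> nat \<Rightarrow> bool" where
  "coded_transition c s k s' \<longleftrightarrow> (\<exists>k'<input_size c. \<forall>i<input_dim c.
     box_coord (radius_bound c) s i + input_digit c k i =
     (\<Sum>j<input_dim c. input_entry c i j * box_coord (radius_bound c) s' j) + input_digit c k' i)"

text \<open>Zero is written \<open>int 0\<close> to make it an instance of
  \<open>computable_int_of_nat\<close>.\<close>

definition coded_nonzero :: "nat \<Rightarrow> nat \<Rightarrow> bool" where
  "coded_nonzero c s \<longleftrightarrow> (\<exists>i<input_dim c. box_coord (radius_bound c) s i \<noteq> int 0)"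

text \<open>The candidate set is the mask \<open>p\<close>, with \<open>s\<close> a member iff bit
  \<open>s\<close> is set. Subsets of the box are therefore numbers below
  \<open>2 ^ box_size c\<close>, and every quantifier is bounded.\<close>

definition coded_trap :: "nat \<Rightarrow> bool" where
  "coded_trap c \<longleftrightarrow> (\<exists>p<(2::nat) ^ box_size c. (\<exists>s<box_size c. p div 2 ^ s mod 2 = 1) \<and>
     (\<forall>s<box_size c. p div 2 ^ s mod 2 = 1 \<longrightarrow> coded_nonzero c s \<and>
       (\<forall>k<input_size c. \<exists>s'<box_size c. p div 2 ^ s' mod 2 = 1 \<and> coded_transition c s k s')))"

lemma decidable_coded_trap: "decidable coded_trap"
  unfolding coded_trap_def coded_transition_def coded_nonzero_def box_size_def box_coord_def
    input_dim_def input_entry_def input_size_def input_digit_def radius_bound_def inverse_bound_def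
  by (intro computability_intros)

lemma int_le_int_encode: "\<bar>x\<bar> \<le> int (int_encode x)"
  by (simp add: int_encode_def sum_encode_def)

context digit_system
begin

context
  fixes fs :: "int vec list" and c :: nat
  assumes fs: "set fs = F1" and c: "c = input_code (L, fs)"
begin

lemma c_eq: "c = prod_encode (list_encode (map int_list_code (mat_to_list L)),
    list_encode (map (\<lambda>f. int_list_code (list_of_vec f)) fs))"
  by (simp add: c input_code_def)

lemma length_mat_to_list: "length (mat_to_list L) = d"
  and mat_to_list_nth: "i < d \<Longrightarrow> length (mat_to_list L ! i) = d"
    "i < d \<Longrightarrow> j < d \<Longrightarrow> mat_to_list L ! i ! j = L $$ (i, j)"
  using carrier_matD[OF L_carrier] by (simp_all add: mat_to_list_def)

lemma input_dim_eq: "input_dim c = d"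
  by (simp add: input_dim_def c_eq list_code_length_encode length_mat_to_list)

lemma input_size_eq: "input_size c = length fs"
  by (simp add: input_size_def c_eq list_code_length_encode)

lemma input_entry_eq: "i < d \<Longrightarrow> j < d \<Longrightarrow> input_entry c i j = L $$ (i, j)"
  by (simp add: input_entry_def c_eq list_code_nth_encode length_mat_to_list int_list_code_def
      mat_to_list_nth)

lemma fs_carrier: "k < length fs \<Longrightarrow> fs ! k \<in> carrier_vec d"
  using fs F1_carrier nth_mem by blast

lemma input_digit_eq: "k < length fs \<Longrightarrow> i < d \<Longrightarrow> input_digit c k i = fs ! k $ i"
  using fs_carrier[of k]
  by (simp add: input_digit_def c_eq list_code_nth_encode int_list_code_def list_of_vec_index)

text \<open>A code dominates what it encodes, so the code of the input itself can serve as the size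
  \<open>c\<close> in \<open>radius_bound\<close>.\<close>

lemma dim_le_code: "d \<le> c"
proof -
  have "d \<le> list_encode (map int_list_code (mat_to_list L))"
    using length_le_list_encode[of "map int_list_code (mat_to_list L)"] by (simp add: length_mat_to_list)
  also have "\<dots> \<le> c" unfolding c_eq by (rule le_prod_encode_1)
  finally show ?thesis .
qed

lemma abs_nth_le_code:
  assumes "j < length xs"
  shows "\<bar>xs ! j\<bar> \<le> int (int_list_code xs)"
proof -
  have "int_encode (xs ! j) \<le> int_list_code xs"
    unfolding int_list_code_def using assms by (intro mem_le_list_encode) auto
  then show ?thesis using int_le_int_encode[of "xs ! j"] by linarith
qed

lemma entry_le_code:
  assumes "i < d" "j < d"
  shows "\<bar>L $$ (i, j)\<bar> \<le> int c"
proof -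
  have "int_list_code (mat_to_list L ! i) \<le> list_encode (map int_list_code (mat_to_list L))"
    using assms(1) by (intro mem_le_list_encode) (simp add: length_mat_to_list)
  also have "\<dots> \<le> c" unfolding c_eq by (rule le_prod_encode_1)
  finally show ?thesis
    using abs_nth_le_code[of j "mat_to_list L ! i"] assms mat_to_list_nth by simp
qed

lemma digit_le_code:
  assumes "f \<in> F1" "i < d"
  shows "\<bar>f $ i\<bar> \<le> int c"
proof -
  have "int_list_code (list_of_vec f) \<le> list_encode (map (\<lambda>f. int_list_code (list_of_vec f)) fs)"
    using assms(1) fs by (intro mem_le_list_encode) auto
  also have "\<dots> \<le> c" unfolding c_eq by (rule le_prod_encode_2)
  finally show ?thesis
    using abs_nth_le_code[of i "list_of_vec f"] assms(2) F1_carrier[OF assms(1)]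
    by (simp add: list_of_vec_index)
qed

abbreviation "R \<equiv> radius_bound c"

definition box_vec :: "nat \<Rightarrow> int vec" where
  "box_vec s = vec d (box_coord R s)"

lemma box_vec_in_box: "box_vec s \<in> {z. dim_vec z = d \<and> (\<forall>i<d. \<bar>z $ i\<bar> \<le> int R)}"
proof -
  have "\<bar>box_coord R s i\<bar> \<le> int R" for i
  proof -
    have "(s div (2 * R + 1) ^ i) mod (2 * R + 1) < 2 * R + 1" by (rule mod_less_divisor) simp
    then show ?thesis unfolding box_coord_def by linarith
  qed
  then show ?thesis by (simp add: box_vec_def)
qed

lemma ex_box_vec:
  assumes "dim_vec z = d" "\<forall>i<d. \<bar>z $ i\<bar> \<le> int R"
  shows "\<exists>s<box_size c. box_vec s = z"
proof -
  have "\<exists>s<(2 * R + 1) ^ d. \<forall>i<d. (s div (2 * R + 1) ^ i) mod (2 * R + 1) = nat (z $ i + int R)"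
  proof (rule ex_digits)
    fix i assume "i < d"
    then have "\<bar>z $ i\<bar> \<le> int R" using assms(2) by blast
    then show "nat (z $ i + int R) < 2 * R + 1" by linarith
  qed
  then obtain s where s: "s < box_size c"
      "\<And>i. i < d \<Longrightarrow> (s div (2 * R + 1) ^ i) mod (2 * R + 1) = nat (z $ i + int R)"
    unfolding box_size_def input_dim_eq by blast
  have "box_vec s = z"
  proof (rule eq_vecI)
    fix i assume "i < dim_vec z"
    then have i: "i < d" using assms(1) by simp
    then have "\<bar>z $ i\<bar> \<le> int R" using assms(2) by blast
    then show "box_vec s $ i = z $ i"
      unfolding box_vec_def index_vec[OF i] box_coord_def s(2)[OF i] by linarith
  qed (simp add: box_vec_def assms(1))
  then show ?thesis using s(1) by blast
qed

lemma coded_nonzero_iff: "coded_nonzero c s \<longleftrightarrow> box_vec s \<noteq> 0\<^sub>v d"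
  unfolding coded_nonzero_def input_dim_eq by (auto simp: box_vec_def vec_eq_iff)

lemma coded_transition_iff:
  assumes k: "k < length fs"
  shows "coded_transition c s k s' \<longleftrightarrow> (\<exists>f'\<in>F1. box_vec s + fs ! k = L *\<^sub>v box_vec s' + f')"
proof -
  have "(\<forall>i<d. box_coord R s i + input_digit c k i =
     (\<Sum>j<d. input_entry c i j * box_coord R s' j) + input_digit c k' i) \<longleftrightarrow>
     box_vec s + fs ! k = L *\<^sub>v box_vec s' + fs ! k'" if k': "k' < length fs" for k'
  proof -
    have "(L *\<^sub>v box_vec s') $ i = (\<Sum>j<d. input_entry c i j * box_coord R s' j)" if "i < d" for i
      using that carrier_matD[OF L_carrier]
      by (simp add: scalar_prod_def box_vec_def input_entry_eq lessThan_atLeast0)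
    moreover have "dim_vec (L *\<^sub>v box_vec s') = d" using carrier_matD[OF L_carrier] by simp
    moreover have "dim_vec (fs ! k) = d" "dim_vec (fs ! k') = d"
      using fs_carrier[OF k] fs_carrier[OF k'] by auto
    ultimately show ?thesis
      using input_digit_eq[OF k] input_digit_eq[OF k']
      by (auto simp: vec_eq_iff box_vec_def)
  qed
  then have "coded_transition c s k s' \<longleftrightarrow>
      (\<exists>k'<length fs. box_vec s + fs ! k = L *\<^sub>v box_vec s' + fs ! k')"
    unfolding coded_transition_def input_dim_eq input_size_eq by blast
  also have "\<dots> \<longleftrightarrow> (\<exists>f'\<in>F1. box_vec s + fs ! k = L *\<^sub>v box_vec s' + f')"
    unfolding fs[symmetric] by (metis in_set_conv_nth)
  finally show ?thesis .
qed

text \<open>A mask yields the set of vectors \<open>box_vec s\<close> over its members. Conversely,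
  a trap yields the mask of all its codes; as \<open>box_vec\<close> reaches every vector of the
  box, the closure condition carries over.\<close>

lemma coded_trap_iff: "coded_trap c \<longleftrightarrow> \<not> folner d (F_seq d L F1)"
proof -
  let ?N = "box_size c"
  have mask: "p div 2 ^ s mod 2 = 1 \<longleftrightarrow> s \<in> set_decode p" for p s :: nat
    by (simp add: set_decode_def odd_iff_mod_2_eq_one)
  have all_F1: "(\<forall>k<length fs. Q (fs ! k)) \<longleftrightarrow> (\<forall>f\<in>F1. Q f)" for Q
    unfolding fs[symmetric] by (metis in_set_conv_nth)
  define trap where "trap = (\<lambda>S. (\<exists>s<?N. s \<in> S) \<and> (\<forall>s<?N. s \<in> S \<longrightarrow> box_vec s \<noteq> 0\<^sub>v d \<and>
      (\<forall>f\<in>F1. \<exists>s'<?N. s' \<in> S \<and> (\<exists>f'\<in>F1. box_vec s + f = L *\<^sub>v box_vec s' + f'))))"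
  have "(\<forall>k<length fs. \<exists>s'<?N. s' \<in> set_decode p \<and> coded_transition c s k s') \<longleftrightarrow>
      (\<forall>f\<in>F1. \<exists>s'<?N. s' \<in> set_decode p \<and> (\<exists>f'\<in>F1. box_vec s + f = L *\<^sub>v box_vec s' + f'))" for p s
    unfolding all_F1[symmetric] using coded_transition_iff by auto
  then have "coded_trap c \<longleftrightarrow> (\<exists>p<2 ^ ?N. trap (set_decode p))"
    unfolding coded_trap_def mask coded_nonzero_iff input_size_eq trap_def by simp
  also have "\<dots> \<longleftrightarrow> \<not> folner d (F_seq d L F1)"
    unfolding not_folner_iff_trap[OF r_le_radius_bound[OF dim_le_code entry_le_code digit_le_code], simplified]
  proof
    assume "\<exists>p<2 ^ ?N. trap (set_decode p)"
    then obtain p where p: "trap (set_decode p)" by blast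
    define P where "P = box_vec ` {s. s < ?N \<and> s \<in> set_decode p}"
    have p1: "P \<subseteq> {z. dim_vec z = d \<and> (\<forall>i<d. \<bar>z $ i\<bar> \<le> int R)}"
      unfolding P_def using box_vec_in_box by blast
    have p2: "P \<noteq> {}" "0\<^sub>v d \<notin> P" using p unfolding P_def trap_def by auto
    have p3: "\<forall>z\<in>P. \<forall>f\<in>F1. \<exists>z'\<in>P. \<exists>f'\<in>F1. z + f = L *\<^sub>v z' + f'"
      using p unfolding P_def trap_def by blast
    show "\<exists>P \<subseteq> {z. dim_vec z = d \<and> (\<forall>i<d. \<bar>z $ i\<bar> \<le> int R)}. P \<noteq> {} \<and> 0\<^sub>v d \<notin> P \<and>
      (\<forall>z\<in>P. \<forall>f\<in>F1. \<exists>z'\<in>P. \<exists>f'\<in>F1. z + f = L *\<^sub>v z' + f')"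
      by (intro exI[of _ P] conjI p1 p2 p3)
  next
    assume "\<exists>P \<subseteq> {z. dim_vec z = d \<and> (\<forall>i<d. \<bar>z $ i\<bar> \<le> int R)}. P \<noteq> {} \<and> 0\<^sub>v d \<notin> P \<and>
      (\<forall>z\<in>P. \<forall>f\<in>F1. \<exists>z'\<in>P. \<exists>f'\<in>F1. z + f = L *\<^sub>v z' + f')"
    then obtain P where P: "P \<subseteq> {z. dim_vec z = d \<and> (\<forall>i<d. \<bar>z $ i\<bar> \<le> int R)}" "P \<noteq> {}" "0\<^sub>v d \<notin> P"
      "\<forall>z\<in>P. \<forall>f\<in>F1. \<exists>z'\<in>P. \<exists>f'\<in>F1. z + f = L *\<^sub>v z' + f'"
      by (elim exE conjE)
    define S where "S = {s. s < ?N \<and> box_vec s \<in> P}"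
    have code: "\<exists>s\<in>S. box_vec s = z" if "z \<in> P" for z
    proof -
      have "dim_vec z = d" "\<forall>i<d. \<bar>z $ i\<bar> \<le> int R" using P(1) that by auto
      then obtain s where "s < ?N" "box_vec s = z" using ex_box_vec by blast
      then show ?thesis using that by (intro bexI[of _ s]) (auto simp: S_def)
    qed
    have "trap S" unfolding trap_def
    proof (intro conjI allI impI ballI)
      show "\<exists>s<?N. s \<in> S" using P(2) code unfolding S_def by blast
      fix s assume s: "s < ?N" "s \<in> S"
      then have sP: "box_vec s \<in> P" by (simp add: S_def)
      then show "box_vec s \<noteq> 0\<^sub>v d" using P(3) by metis
      fix f assume f: "f \<in> F1"
      obtain z' f' where z': "z' \<in> P" "f' \<in> F1" "box_vec s + f = L *\<^sub>v z' + f'"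
        using bspec[OF bspec[OF P(4) sP] f] by (elim bexE)
      obtain s' where s': "s' \<in> S" "box_vec s' = z'" using code[OF z'(1)] by (elim bexE)
      have "s' < ?N" using s'(1) by (simp add: S_def)
      then show "\<exists>s'<?N. s' \<in> S \<and> (\<exists>f'\<in>F1. box_vec s + f = L *\<^sub>v box_vec s' + f')"
        using s' z'(2,3) by (intro exI[of _ s'] conjI bexI[of _ f']) simp_all
    qed
    moreover have "set_decode (set_encode S) = S" by (simp add: S_def)
    moreover have "set_encode S < 2 ^ ?N" by (rule set_encode_less) (auto simp: S_def)
    ultimately show "\<exists>p<2 ^ ?N. trap (set_decode p)" by (intro exI[of _ "set_encode S"]) simp
  qed
  finally show ?thesis .
qed

end

end

theorem theorem3p2:
  shows "(\<forall>d L F1. admissible d L F1 \<longrightarrow>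
           (folner d (F_seq d L F1) \<longleftrightarrow>
             (\<exists>n\<ge>1. real n \<le> ((6 * rbar L F1) ^ (3 * d) - (6 * rbar L F1) ^ d) / 6 \<and>
                contains_translate d (F_seq d L F1 n)
                  (C_set d L F1 + lattice_ball d (rbar L F1)))))
       \<and> decidable_on input_code
           {(L, fs). \<exists>d. admissible d L (set fs)}
           (\<lambda>(L, fs). folner (dim_row L) (F_seq (dim_row L) L (set fs)))"
proof
  show "\<forall>d L F1. admissible d L F1 \<longrightarrow>
           (folner d (F_seq d L F1) \<longleftrightarrow>
             (\<exists>n\<ge>1. real n \<le> ((6 * rbar L F1) ^ (3 * d) - (6 * rbar L F1) ^ d) / 6 \<and>
                contains_translate d (F_seq d L F1 n)
                  (C_set d L F1 + lattice_ball d (rbar L F1))))"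
  proof (intro allI impI)
    fix d L F1 assume "admissible d L F1"
    then interpret digit_system d L F1 by unfold_locales
    show "folner d (F_seq d L F1) \<longleftrightarrow>
             (\<exists>n\<ge>1. real n \<le> ((6 * rbar L F1) ^ (3 * d) - (6 * rbar L F1) ^ d) / 6 \<and>
                contains_translate d (F_seq d L F1 n)
                  (C_set d L F1 + lattice_ball d (rbar L F1)))"
      using folner_iff_contains_translate unfolding r_def .
  qed
  \<comment> \<open>A trap witnesses failure, so the answer is the negation. One function serves all
    dimensions, because the dimension is read off the code.\<close>
  have "total_rec 1 (\<lambda>xs. of_bool (\<not> coded_trap (xs ! 0)))"
    using decidable_not[OF decidable_coded_trap] unfolding decidable_def computable_def .
  then obtain g where g: "recursive 1 g" "\<And>xs. length xs = 1 \<Longrightarrow> g xs = of_bool (\<not> coded_trap (xs ! 0))"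
    unfolding total_rec_def by blast
  have "g [input_code (L, fs)] = (if folner (dim_row L) (F_seq (dim_row L) L (set fs)) then 1 else 0)"
    if "admissible d L (set fs)" for d L fs
  proof -
    interpret digit_system d L "set fs" by unfold_locales (rule that)
    have "coded_trap (input_code (L, fs)) \<longleftrightarrow> \<not> folner (dim_row L) (F_seq (dim_row L) L (set fs))"
      using coded_trap_iff[OF refl refl] carrier_matD(1)[OF L_carrier] by simp
    then show ?thesis using g(2)[of "[input_code (L, fs)]"] by simp
  qed
  then show "decidable_on input_code {(L, fs). \<exists>d. admissible d L (set fs)}
      (\<lambda>(L, fs). folner (dim_row L) (F_seq (dim_row L) L (set fs)))"
    unfolding decidable_on_def using g(1) by (intro exI[of _ g]) auto
qed

end
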